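(* Let $k\ge 0$ and let $0=w_0<w_1<\dots<w_k<w_{k+1}=1$ be fixed nodes. Let $\mathrm{T}_M$ be a finite-dimensional subspace of $L^2(0,1)$ with $\mathrm{T}_M\subseteq\mathrm{H}^1_w(0,1)$, let $L\in\mathbb{N}$, and let $$\mathrm{S}_L=\left\{g\in L^2(0,1): g|_{[l/L,(l+1)/L)}\text{ is constant for each } l=0,\dots,L-1\right\}.$$ If $L^{-1}\le\eta=\min_{j=0,\dots,k}\{w_{j+1}-w_j\}$, then $$G(\mathrm{S}_L,\mathrm{T}_M)\le\sqrt{\frac{\gamma_M^2}{(\pi L)^2}+\frac{4\zeta_M^2}{L}},$$ where $$\gamma_M=\max_{j=0,\dots,k}\sup\left\{\|f'\|_{(w_j,w_{j+1})}: f\in\mathrm{T}_M,\ \|f\|_{(w_j,w_{j+1})}=1\right\},$$ $$\zeta_M=\max_{j=0,\dots,k}\sup\left\{\|f\|_{\infty,(w_j,w_{j+1})}: f\in\mathrm{T}_M,\ \|f\|_{(w_j,w_{j+1})}=1\right\}.$$ Moreover, if $k=0$, i.e. $\mathrm{T}_M\subseteq\mathrm{H}^1(0,1)$, then $G(\mathrm{S}_L,\mathrm{T}_M)\le\gamma_M/(\pi L)$.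
   Context: $\mathbb{N}=\{1,2,\dots\}$. All functions are complex-valued. For an interval $I$, $\|f\|_I=\left(\int_I|f(x)|^2\,dx\right)^{1/2}$ and $\|f\|_{\infty,I}=\operatorname{ess\,sup}_{x\in I}|f(x)|$; $\mathrm{H}^1(I)$ is the usual Sobolev space on $I$. Define $$\mathrm{H}^1_w(0,1)=\{f: f|_{(w_j,w_{j+1})}\in\mathrm{H}^1(w_j,w_{j+1}),\ j=0,\dots,k\},$$ so that $\mathrm{H}^1_w(0,1)=\mathrm{H}^1(0,1)$ when $k=0$. In $\gamma_M$, $f'$ denotes the weak derivative of $f$ on $(w_j,w_{j+1})$. The supremum of the empty set is taken to be $0$. For closed subspaces $\mathrm{U},\mathrm{V}$ of $L^2(0,1)$ with orthogonal projections $\mathcal{P}_{\mathrm{U}},\mathcal{P}_{\mathrm{V}}$, the gap is $G(\mathrm{U},\mathrm{V})=\|(\mathcal{I}-\mathcal{P}_{\mathrm{U}})\mathcal{P}_{\mathrm{V}}\|$ (operator norm), where $\mathcal{I}$ is the identity on $L^2(0,1)$. *)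

theory Defs
  imports "HOL-Analysis.Analysis" "HOL-Probability.Essential_Supremum"
begin

section \<open>The Hilbert space of square-integrable functions on a set of reals\<close>

text \<open>
  Elements of \<open>L\<^sup>2(I)\<close> are represented by functions on the whole real line whose values
  outside \<open>I\<close> are irrelevant; two functions represent the same element if they agree almost
  everywhere on \<open>I\<close>.
\<close>

definition L2 :: "real set \<Rightarrow> (real \<Rightarrow> complex) set" where
  "L2 I = {f \<in> borel_measurable (lebesgue_on I).
             integrable (lebesgue_on I) (\<lambda>x. (cmod (f x))\<^sup>2)}"

definition L2_norm :: "real set \<Rightarrow> (real \<Rightarrow> complex) \<Rightarrow> real" where
  "L2_norm I f = sqrt (\<integral>x. (cmod (f x))\<^sup>2 \<partial>lebesgue_on I)"

definition L2_inner :: "real set \<Rightarrow> (real \<Rightarrow> complex) \<Rightarrow> (real \<Rightarrow> complex) \<Rightarrow> complex" where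
  "L2_inner I f g = (\<integral>x. f x * cnj (g x) \<partial>lebesgue_on I)"

text \<open>
  Subspaces of \<open>L\<^sup>2(I)\<close> correspond to sets of representatives that are closed under linear
  combinations and under almost-everywhere equality.
\<close>

definition L2_subspace :: "real set \<Rightarrow> (real \<Rightarrow> complex) set \<Rightarrow> bool" where
  "L2_subspace I U \<longleftrightarrow>
     U \<subseteq> L2 I \<and> (\<lambda>x. 0) \<in> U \<and>
     (\<forall>f\<in>U. \<forall>g\<in>U. (\<lambda>x. f x + g x) \<in> U) \<and>
     (\<forall>c. \<forall>f\<in>U. (\<lambda>x. c * f x) \<in> U) \<and>
     (\<forall>f\<in>U. \<forall>g\<in>L2 I. (AE x in lebesgue_on I. f x = g x) \<longrightarrow> g \<in> U)"

definition L2_finite_dim :: "real set \<Rightarrow> (real \<Rightarrow> complex) set \<Rightarrow> bool" where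
  "L2_finite_dim I U \<longleftrightarrow>
     (\<exists>B. finite B \<and> B \<subseteq> U \<and>
        (\<forall>f\<in>U. \<exists>c. AE x in lebesgue_on I. f x = (\<Sum>b\<in>B. c b * b x)))"

text \<open>
  For a closed subspace \<open>U\<close> and \<open>f \<in> L\<^sup>2(I)\<close> the projection exists and is unique up to almost-everywhere
  equality; the choice below selects one representative.
\<close>

definition L2_proj :: "real set \<Rightarrow> (real \<Rightarrow> complex) set \<Rightarrow> (real \<Rightarrow> complex) \<Rightarrow> (real \<Rightarrow> complex)" where
  "L2_proj I U f =
     (SOME g. g \<in> U \<and> (\<forall>u\<in>U. L2_inner I (\<lambda>x. f x - g x) u = 0))"

definition L2_onorm :: "real set \<Rightarrow> ((real \<Rightarrow> complex) \<Rightarrow> (real \<Rightarrow> complex)) \<Rightarrow> real" where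
  "L2_onorm I A = (SUP f\<in>{f \<in> L2 I. L2_norm I f \<le> 1}. L2_norm I (A f))"

definition gap :: "(real \<Rightarrow> complex) set \<Rightarrow> (real \<Rightarrow> complex) set \<Rightarrow> real" where
  "gap U V =
     (let I = {0<..<1}; P = L2_proj I U; Q = L2_proj I V
      in L2_onorm I (\<lambda>f x. Q f x - P (Q f) x))"


section \<open>Weak derivatives and Sobolev spaces\<close>

text \<open>
  In \<open>test_function\<close>, \<open>D n\<close> is the \<open>n\<close>-th derivative of \<open>\<phi>\<close>.
\<close>

definition test_function :: "real set \<Rightarrow> (real \<Rightarrow> complex) \<Rightarrow> bool" where
  "test_function I \<phi> \<longleftrightarrow>
     (\<exists>D. D 0 = \<phi> \<and> (\<forall>n x. (D n has_vector_derivative D (Suc n) x) (at x))) \<and>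
     (\<exists>K. compact K \<and> K \<subseteq> I \<and> (\<forall>x. x \<notin> K \<longrightarrow> \<phi> x = 0))"

definition locally_integrable_on :: "(real \<Rightarrow> complex) \<Rightarrow> real set \<Rightarrow> bool" where
  "locally_integrable_on f I \<longleftrightarrow>
     (\<forall>K. compact K \<and> K \<subseteq> I \<longrightarrow> integrable (lebesgue_on K) f)"

definition has_weak_derivative :: "real set \<Rightarrow> (real \<Rightarrow> complex) \<Rightarrow> (real \<Rightarrow> complex) \<Rightarrow> bool" where
  "has_weak_derivative I f g \<longleftrightarrow>
     locally_integrable_on f I \<and> locally_integrable_on g I \<and>
     (\<forall>\<phi>. test_function I \<phi> \<longrightarrow>
        (\<integral>x. f x * vector_derivative \<phi> (at x) \<partial>lebesgue_on I) =
        - (\<integral>x. g x * \<phi> x \<partial>lebesgue_on I))"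

definition weak_deriv :: "real set \<Rightarrow> (real \<Rightarrow> complex) \<Rightarrow> (real \<Rightarrow> complex)" where
  "weak_deriv I f = (SOME g. has_weak_derivative I f g)"

definition H1 :: "real set \<Rightarrow> (real \<Rightarrow> complex) set" where
  "H1 I = {f \<in> L2 I. \<exists>g \<in> L2 I. has_weak_derivative I f g}"

definition H1_pw :: "nat \<Rightarrow> (nat \<Rightarrow> real) \<Rightarrow> (real \<Rightarrow> complex) set" where
  "H1_pw k w = {f. \<forall>j\<le>k. f \<in> H1 {w j<..<w (Suc j)}}"


section \<open>Step functions and the constants of the estimate\<close>

definition step_space :: "nat \<Rightarrow> (real \<Rightarrow> complex) set" where
  "step_space L =
     {g \<in> L2 {0<..<1}. \<forall>l<L. \<exists>c. AE x in lebesgue_on {0<..<1}.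
        x \<in> {real l / real L ..< (real l + 1) / real L} \<longrightarrow> g x = c}"

text \<open>
  The suprema are taken in the extended nonnegative reals, where the supremum of the empty set is
  \<open>0\<close>.
\<close>

definition gamma_const :: "nat \<Rightarrow> (nat \<Rightarrow> real) \<Rightarrow> (real \<Rightarrow> complex) set \<Rightarrow> ennreal" where
  "gamma_const k w T =
     (MAX j\<in>{..k}. let I = {w j<..<w (Suc j)} in
        SUP f\<in>{f \<in> T. L2_norm I f = 1}. ennreal (L2_norm I (weak_deriv I f)))"

definition zeta_const :: "nat \<Rightarrow> (nat \<Rightarrow> real) \<Rightarrow> (real \<Rightarrow> complex) set \<Rightarrow> ennreal" where
  "zeta_const k w T =
     (MAX j\<in>{..k}. let I = {w j<..<w (Suc j)} in
        SUP f\<in>{f \<in> T. L2_norm I f = 1}. esssup (lebesgue_on I) (\<lambda>x. ennreal (cmod (f x))))"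

end

theory Submission
  imports Defs "HOL-Computational_Algebra.Polynomial" "HOL-Real_Asymp.Real_Asymp"
begin

text \<open>
  The gap is the largest distance from a \<open>t\<close> in the unit ball of \<open>T\<close> to the step functions, and it is
  estimated by one explicit step function. On a cell without a node in its interior,
  take the mean of \<open>t\<close>: Wirtinger's inequality with the sharp constant \<open>1 / (\<pi> L)\<close> bounds the error
  by the derivative. On a cell that contains a node take \<open>0\<close>: there \<open>\<bar>t\<bar> \<le> \<zeta> \<parallel>t\<parallel>\<close> on each piece of the
  partition, and every piece meets at most two such cells. The constants \<open>\<gamma>\<close> and \<open>\<zeta>\<close> must be shown
  to be finite, because \<open>enn2real\<close> maps \<open>\<infinity>\<close> to \<open>0\<close>; for \<open>\<gamma>\<close> this is the boundedness of
  seminorms on finite-dimensional spaces, and \<open>\<zeta>\<close> is controlled by \<open>\<gamma>\<close>.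
\<close>

text \<open>Two obstacles shape the proof. A weak derivative is known only through its pairing with
  test functions, so before any estimate a function in \<open>H1\<close> has to be rewritten, almost
  everywhere, as a constant plus the indefinite integral of its weak derivative; this takes a supply
  of test functions, built from exp(-1/x), and the lemma of du Bois-Reymond. Moreover, that
  derivative is merely square integrable, while the pointwise cotangent argument wants a continuous
  derivative. The argument is therefore run one integration higher, where having mean zero turns
  into vanishing at both ends. The value 0 on a cell with a node avoids comparing t across a jump:
  the error there is the mass of t itself, and a cell of length 1/L carries at most \<zeta>^2/L
  times the squared norm of t on each piece that it meets. Such a cell meets a piece only if it
  contains an end point of that piece, whence the count of two. Without interior nodes there are no
  such cells, the second term disappears, and the sharper claim for k = 0 comes out of the same
  estimate.\<close>

section \<open>Bump functions\<close>

text \<open>The polynomial in 1/x is there for closure: the derivative of a \<open>flat p\<close> is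
  again some \<open>flat q\<close>, including at 0, so smoothness takes no separate treatment of
  higher derivatives.\<close>

definition flat :: "real poly \<Rightarrow> real \<Rightarrow> real" where
  "flat p x = (if x > 0 then poly p (1 / x) * exp (- (1 / x)) else 0)"

lemma poly_div_exp_at_top: "((\<lambda>y. poly p y / exp y) \<longlongrightarrow> (0::real)) at_top"
proof -
  have "((\<lambda>y. \<Sum>i\<le>degree p. coeff p i * (y ^ i / exp y)) \<longlongrightarrow> (\<Sum>i\<le>degree p. coeff p i * 0)) at_top"
    by (intro tendsto_sum tendsto_mult tendsto_const tendsto_power_div_exp_0)
  then show ?thesis by (simp add: poly_altdef sum_divide_distrib)
qed

lemma flat_tendsto_0: "(flat p \<longlongrightarrow> 0) (at 0)"
proof -
  have "((\<lambda>x. poly p (inverse x) / exp (inverse x)) \<longlongrightarrow> 0) (at_right (0::real))"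
    by (rule filterlim_compose[OF poly_div_exp_at_top filterlim_inverse_at_top_right])
  moreover have "\<forall>\<^sub>F x in at_right 0. poly p (inverse x) / exp (inverse x) = flat p x"
    unfolding eventually_at_right_field
    by (intro exI[of _ 1]) (auto simp: flat_def exp_minus field_simps)
  ultimately have 1: "(flat p \<longlongrightarrow> 0) (at_right 0)"
    by (rule Lim_transform_eventually)
  have "\<forall>\<^sub>F x in at_left 0. 0 = flat p x"
    unfolding eventually_at_left_field
    by (intro exI[of _ "-1"]) (auto simp: flat_def)
  then have 2: "(flat p \<longlongrightarrow> 0) (at_left 0)"
    by (rule Lim_transform_eventually[OF tendsto_const])
  show ?thesis by (rule filterlim_split_at[OF 2 1])
qed

text \<open>In the variable y = 1/x the chain rule contributes the factor y^2, which is
  \<open>[:0, 0, 1:]\<close>, and the exponential contributes the p in p - p'.\<close>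

lemma flat_has_derivative:
  "(flat p has_real_derivative flat ([:0, 0, 1:] * (p - pderiv p)) x) (at x)"
proof -
  consider "x > 0" | "x < 0" | "x = 0" by linarith
  then show ?thesis
  proof cases
    case 1
    have "((\<lambda>x. poly p (1 / x) * exp (- (1 / x))) has_real_derivative
          flat ([:0, 0, 1:] * (p - pderiv p)) x) (at x)"
      using 1 by (auto intro!: derivative_eq_intros poly_DERIV[THEN DERIV_chain2]
          simp: flat_def field_simps power2_eq_square)
    then show ?thesis
      by (rule has_field_derivative_transform_within_open[of _ _ _ "{0<..}"])
        (use 1 in \<open>auto simp: flat_def\<close>)
  next
    case 2
    have "((\<lambda>x. 0) has_real_derivative flat ([:0, 0, 1:] * (p - pderiv p)) x) (at x)"
      using 2 by (simp add: flat_def)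
    then show ?thesis
      by (rule has_field_derivative_transform_within_open[of _ _ _ "{..<0}"])
        (use 2 in \<open>auto simp: flat_def\<close>)
  next
    case 3
    \<comment> \<open>Division by h = 1/y multiplies the polynomial by y, so the difference quotient
      at 0 is again in the family and tends to 0.\<close>
    have eq: "(\<lambda>h. (flat p (0 + h) - flat p 0) / h) = flat ([:0, 1:] * p)"
      by (auto simp: flat_def)
    have "((\<lambda>h. (flat p (0 + h) - flat p 0) / h) \<longlongrightarrow> 0) (at 0)"
      unfolding eq by (rule flat_tendsto_0)
    then show ?thesis
      using 3 by (simp add: DERIV_def flat_def)
  qed
qed

text \<open>\<open>test_function\<close> asks for a whole sequence of derivatives. In a class closed
  under differentiation such a sequence arises by iterating one chosen derivative; closure under
  products admits the two-sided bumps, closure under sums the product rule and mean-zero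
  combinations of bumps.\<close>

inductive flat_alg :: "(real \<Rightarrow> complex) \<Rightarrow> bool" where
  flat: "flat_alg (\<lambda>x. of_real (c * flat p (a * x + b)))"
| add: "flat_alg f \<Longrightarrow> flat_alg g \<Longrightarrow> flat_alg (\<lambda>x. f x + g x)"
| mult: "flat_alg f \<Longrightarrow> flat_alg g \<Longrightarrow> flat_alg (\<lambda>x. f x * g x)"

lemma flat_alg_cmult:
  assumes "flat_alg f"
  shows "flat_alg (\<lambda>x. of_real s * f x)"
  using assms
proof induction
  case (flat c p a b)
  have "(\<lambda>x. complex_of_real s * of_real (c * flat p (a * x + b)))
      = (\<lambda>x. of_real ((s * c) * flat p (a * x + b)))" by (simp add: mult.assoc)
  then show ?case using flat_alg.flat by presburger
next
  case (add f g)
  then show ?case using flat_alg.add by (fastforce simp: distrib_left)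
next
  case (mult f g)
  then show ?case using flat_alg.mult by (fastforce simp: mult.assoc[symmetric])
qed

lemma flat_alg_deriv:
  assumes "flat_alg f"
  shows "\<exists>f'. flat_alg f' \<and> (\<forall>x. (f has_vector_derivative f' x) (at x))"
  using assms
proof induction
  case (flat c p a b)
  let ?q = "[:0, 0, 1:] * (p - pderiv p)"
  have "((\<lambda>x. c * flat p (a * x + b)) has_real_derivative (c * a) * flat ?q (a * x + b)) (at x)" for x
    by (auto intro!: derivative_eq_intros flat_has_derivative[THEN DERIV_chain2] simp del: mult_pCons_left)
  then show ?case
    by (intro exI[of _ "\<lambda>x. of_real ((c * a) * flat ?q (a * x + b))"] conjI flat_alg.flat allI
        has_vector_derivative_of_real)
      (simp add: has_real_derivative_iff_has_vector_derivative)
next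
  case (add f g)
  then obtain f' g' where "flat_alg f'" "flat_alg g'"
    "\<forall>x. (f has_vector_derivative f' x) (at x)" "\<forall>x. (g has_vector_derivative g' x) (at x)" by blast
  then show ?case
    by (intro exI[of _ "\<lambda>x. f' x + g' x"] conjI flat_alg.add allI has_vector_derivative_add) auto
next
  case (mult f g)
  then obtain f' g' where "flat_alg f'" "flat_alg g'"
    "\<forall>x. (f has_vector_derivative f' x) (at x)" "\<forall>x. (g has_vector_derivative g' x) (at x)" by blast
  then show ?case using mult
    by (intro exI[of _ "\<lambda>x. f x * g' x + f' x * g x"] conjI flat_alg.add flat_alg.mult allI
        has_vector_derivative_mult) auto
qed

lemma flat_alg_smooth:
  assumes "flat_alg f"
  shows "\<exists>D. D 0 = f \<and> (\<forall>n x. (D n has_vector_derivative D (Suc n) x) (at x))"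
proof -
  obtain d where d: "\<And>f. flat_alg f \<Longrightarrow> flat_alg (d f) \<and> (\<forall>x. (f has_vector_derivative d f x) (at x))"
    using flat_alg_deriv by metis
  have "flat_alg ((d ^^ n) f)" for n
    by (induction n) (use assms d in auto)
  then show ?thesis
    using d by (intro exI[of _ "\<lambda>n. (d ^^ n) f"]) auto
qed

lemma flat_alg_continuous: "flat_alg f \<Longrightarrow> continuous_on S f"
  using flat_alg_deriv
  by (meson continuous_at_imp_continuous_on has_vector_derivative_continuous)

text \<open>The parameter \<open>n\<close> steepens both flanks, so that for fixed \<open>c\<close>
  and \<open>d\<close> the bumps tend pointwise to the indicator of the open interval while staying
  between 0 and 1; \<open>Suc n\<close> keeps the scale positive.\<close>

definition bump :: "nat \<Rightarrow> real \<Rightarrow> real \<Rightarrow> real \<Rightarrow> real" where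
  "bump n c d x = flat 1 (real (Suc n) * (x - c)) * flat 1 (real (Suc n) * (d - x))"

lemma bump_alg: "flat_alg (\<lambda>x. of_real (bump n c d x))"
proof -
  have "(\<lambda>x. complex_of_real (bump n c d x)) =
     (\<lambda>x. of_real (1 * flat 1 (real (Suc n) * x + (- real (Suc n) * c))) *
          of_real (1 * flat 1 (- real (Suc n) * x + real (Suc n) * d)))"
    by (auto simp: bump_def algebra_simps)
  then show ?thesis using flat_alg.mult[OF flat_alg.flat flat_alg.flat] by presburger
qed

lemma bump_pos: "c < x \<Longrightarrow> x < d \<Longrightarrow> bump n c d x > 0"
  by (simp add: bump_def flat_def)

lemma bump_outside: "x \<notin> {c<..<d} \<Longrightarrow> bump n c d x = 0"
  by (auto simp: bump_def flat_def zero_less_mult_iff simp del: of_nat_Suc)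

lemma flat_1_bounds: "0 \<le> flat 1 x" "flat 1 x \<le> 1"
  by (simp_all add: flat_def)

lemma bump_bounds: "0 \<le> bump n c d x" "bump n c d x \<le> 1"
  by (simp_all add: bump_def flat_1_bounds mult_le_one)

lemma flat_1_scaled_tendsto: "0 < y \<Longrightarrow> (\<lambda>n. flat 1 (real (Suc n) * y)) \<longlonglongrightarrow> 1"
proof -
  assume y: "0 < y"
  have "(\<lambda>n. exp (- (inverse y * inverse (real (Suc n))))) \<longlonglongrightarrow> exp (- (inverse y * 0))"
    by (intro tendsto_intros LIMSEQ_inverse_real_of_nat)
  then show ?thesis using y by (simp add: flat_def field_simps del: of_nat_Suc)
qed

lemma bump_tendsto: "(\<lambda>n. bump n c d x) \<longlonglongrightarrow> indicator {c<..<d} x"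
proof (cases "x \<in> {c<..<d}")
  case True
  then have "(\<lambda>n. bump n c d x) \<longlonglongrightarrow> 1 * 1"
    unfolding bump_def by (intro tendsto_mult flat_1_scaled_tendsto) auto
  with True show ?thesis by simp
qed (simp add: bump_outside)

lemma test_function_bump:
  assumes "{c..d} \<subseteq> I"
  shows "test_function I (\<lambda>x. of_real (bump n c d x))"
  unfolding test_function_def using flat_alg_smooth[OF bump_alg] assms
  by (intro conjI exI[of _ "{c..d}"]) (auto simp: bump_outside)

text \<open>The primitive of \<open>h\<close> from \<open>c\<close> is constant on either side of
  the interval: zero on the left by its starting point, zero on the right because the total integral
  vanishes. Hence every mean-zero \<open>h\<close> of this kind is the derivative of a test
  function.\<close>

lemma test_function_antiderivative:
  assumes h: "flat_alg h" and supp: "\<And>x. x \<notin> {c..d} \<Longrightarrow> h x = 0" and cd: "c \<le> d" "{c..d} \<subseteq> I"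
    and int0: "integral {c..d} h = 0"
  obtains \<phi> where "test_function I \<phi>" "\<And>x. (\<phi> has_vector_derivative h x) (at x)"
proof -
  define \<phi> where "\<phi> u = (LBINT y=c..u. h y)" for u :: real
  have der: "(\<phi> has_vector_derivative h x) (at x)" for x
  proof -
    \<comment> \<open>The interval contains \<open>c\<close> and has \<open>x\<close> in its
      interior, so the derivative within it is the full derivative.\<close>
    define A B where "A = min c x - 1" and "B = max c x + 1"
    have "((\<lambda>u. LBINT y=c..u. h y) has_vector_derivative h x) (at x within {A..B})"
      by (rule interval_integral_FTC2) (auto simp: A_def B_def intro: flat_alg_continuous h)
    moreover have "at x within {A..B} = at x"
      by (rule at_within_interior) (auto simp: A_def B_def)
    ultimately show ?thesis unfolding \<phi>_def by simp
  qed
  have const: "\<phi> x = \<phi> y" if "convex S" "S \<inter> {c<..<d} = {}" "x \<in> S" "y \<in> S" "\<And>z. z \<in> S \<Longrightarrow> h z = 0" for S x y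
    using that der has_vector_derivative_zero_constant[of S \<phi>]
    by (metis has_vector_derivative_at_within)
  have cont: "continuous_on UNIV h" by (rule flat_alg_continuous[OF h])
  \<comment> \<open>\<open>supp\<close> is silent about the end points. Continuity makes
    \<open>h\<close> vanish there too, and hence on the closed half-lines to which
    \<open>const\<close> is applied.\<close>
  have ends: "h c = 0" "h d = 0"
  proof -
    have c0: "isCont h c" "isCont h d"
      using cont by (simp_all add: continuous_on_eq_continuous_at)
    have "(h \<longlongrightarrow> h c) (at_left c)"
      using c0(1) by (simp add: isCont_def filterlim_at_split)
    moreover have "(h \<longlongrightarrow> 0) (at_left c)"
      by (rule Lim_transform_eventually[OF tendsto_const])
         (auto simp: eventually_at_left_field supp intro!: exI[of _ "c-1"])
    ultimately show "h c = 0" using tendsto_unique trivial_limit_at_left_real by blast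
    have "(h \<longlongrightarrow> h d) (at_right d)"
      using c0(2) by (simp add: isCont_def filterlim_at_split)
    moreover have "(h \<longlongrightarrow> 0) (at_right d)"
      by (rule Lim_transform_eventually[OF tendsto_const])
         (auto simp: eventually_at_right_field supp intro!: exI[of _ "d+1"])
    ultimately show "h d = 0" using tendsto_unique trivial_limit_at_right_real by blast
  qed
  have "\<phi> c = 0" by (simp add: \<phi>_def)
  have "(h has_integral (\<phi> d - \<phi> c)) {c..d}"
    using cd(1) der by (intro fundamental_theorem_of_calculus) (auto intro: has_vector_derivative_at_within)
  then have "\<phi> d = 0" using int0 \<open>\<phi> c = 0\<close> by (simp add: integral_unique)
  have "\<phi> x = 0" if "x \<notin> {c..d}" for x
  proof (cases "x < c")
    case True
    have "\<phi> x = \<phi> c"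
      by (rule const[of "{..c}"]) (use True ends supp in \<open>force+\<close>)
    then show ?thesis using \<open>\<phi> c = 0\<close> by simp
  next
    case False
    with that have "d < x" by auto
    have "\<phi> x = \<phi> d"
      by (rule const[of "{d..}"]) (use \<open>d < x\<close> ends supp in \<open>force+\<close>)
    then show ?thesis using \<open>\<phi> d = 0\<close> by simp
  qed
  moreover obtain D where D: "D 0 = h" "\<And>n x. (D n has_vector_derivative D (Suc n) x) (at x)"
    using flat_alg_smooth[OF h] by blast
  \<comment> \<open>The derivative sequence of \<open>\<phi>\<close> is that of \<open>h\<close>,
    shifted by one place.\<close>
  have "\<exists>D. D 0 = \<phi> \<and> (\<forall>n x. (D n has_vector_derivative D (Suc n) x) (at x))"
    by (intro exI[of _ "case_nat \<phi> D"]) (use D der in \<open>auto split: nat.split\<close>)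
  ultimately have "test_function I \<phi>"
    unfolding test_function_def using cd by (intro conjI exI[of _ "{c..d}"]) auto
  then show ?thesis using that der by blast
qed

section \<open>The lemma of du Bois-Reymond\<close>

lemma integrable_lebesgue_on_iff:
  assumes "S \<in> sets lebesgue"
  shows "integrable (lebesgue_on S) f \<longleftrightarrow> f absolutely_integrable_on S"
  using assms by (simp add: integrable_restrict_space set_integrable_def)

lemma integrable_lebesgue_on_Icc_iff_Ioo:
  fixes f :: "real \<Rightarrow> 'a::euclidean_space"
  shows "integrable (lebesgue_on {a..b}) f \<longleftrightarrow> integrable (lebesgue_on {a<..<b}) f"
  by (simp add: integrable_lebesgue_on_iff absolutely_integrable_on_Icc_iff_Ioo)

lemma integral_lebesgue_on_restrict:
  fixes f :: "real \<Rightarrow> 'a::euclidean_space"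
  assumes "S \<subseteq> T" "S \<in> sets lebesgue" "T \<in> sets lebesgue" "\<And>x. x \<in> T - S \<Longrightarrow> f x = 0"
  shows "integral\<^sup>L (lebesgue_on T) f = integral\<^sup>L (lebesgue_on S) f"
proof -
  have "integral\<^sup>L (lebesgue_on T) f = integral\<^sup>L (lebesgue_on T) (\<lambda>x. if x \<in> S then f x else 0)"
    by (rule Bochner_Integration.integral_cong) (use assms(4) in auto)
  then show ?thesis using integral_restrict[OF assms(1-3), of f] by simp
qed

lemma integrable_lebesgue_on_subset:
  fixes f :: "'a::euclidean_space \<Rightarrow> 'b::euclidean_space"
  assumes "integrable (lebesgue_on T) f" "S \<subseteq> T" "S \<in> sets lebesgue" "T \<in> sets lebesgue"
  shows "integrable (lebesgue_on S) f"
  using set_integrable_subset[of lebesgue T f S] assms by (simp add: integrable_lebesgue_on_iff)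

lemma AE_lebesgue_on_subset:
  assumes "AE x in lebesgue_on T. P x" "S \<subseteq> T" "S \<in> sets lebesgue" "T \<in> sets lebesgue"
  shows "AE x in lebesgue_on S. P x"
  using assms by (auto simp: AE_restrict_space_iff)

lemma bump_borel_measurable [measurable]: "(\<lambda>x. complex_of_real (bump n c d x)) \<in> borel_measurable borel"
  by (intro borel_measurable_continuous_onI flat_alg_continuous bump_alg)

lemma integrable_mult_bump:
  fixes k :: "real \<Rightarrow> complex"
  assumes "integrable (lebesgue_on S) k"
  shows "integrable (lebesgue_on S) (\<lambda>x. k x * of_real (bump n c d x))"
proof (rule Bochner_Integration.integrable_bound[OF assms])
  have [measurable]: "(\<lambda>x. complex_of_real (bump n c d x)) \<in> borel_measurable (lebesgue_on S)"
    by (intro measurable_restrict_space1 measurable_completion) simp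
  show "(\<lambda>x. k x * of_real (bump n c d x)) \<in> borel_measurable (lebesgue_on S)"
    using borel_measurable_integrable[OF assms] by measurable
  show "AE x in lebesgue_on S. norm (k x * of_real (bump n c d x)) \<le> norm (k x)"
    by (intro AE_I2) (simp add: norm_mult bump_bounds mult_left_le)
qed

text \<open>The bumps converge boundedly to the indicator of \<open>{c<..<d}\<close>, so all integrals of \<open>k\<close> over
  subintervals vanish, and Lebesgue differentiation applies.\<close>
lemma AE_zero_if_bump_integrals_zero:
  assumes li: "locally_integrable_on k {a<..<b}"
    and z: "\<And>n c d. a < c \<Longrightarrow> c < d \<Longrightarrow> d < b \<Longrightarrow>
      (\<integral>x. k x * of_real (bump n c d x) \<partial>lebesgue_on {a<..<b}) = 0"
  shows "AE x in lebesgue_on {a<..<b}. k x = 0"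
proof -
  have int: "integrable (lebesgue_on {c..d}) k" if "a < c" "d < b" for c d
  proof -
    have "{c..d} \<subseteq> {a<..<b}" using that by auto
    then show ?thesis using li compact_Icc unfolding locally_integrable_on_def by blast
  qed
  have zero: "integral {c..d} k = 0" if cd: "a < c" "c < d" "d < b" for c d
  proof -
    let ?M = "lebesgue_on {c..d}"
    have k: "integrable ?M k" using int cd by auto
    have meas: "k \<in> borel_measurable ?M" using k by auto
    have "(\<lambda>n. \<integral>x. k x * of_real (bump n c d x) \<partial>?M) \<longlonglongrightarrow> (\<integral>x. k x * of_real (indicator {c<..<d} x) \<partial>?M)"
    proof (rule integral_dominated_convergence[where w = "\<lambda>x. norm (k x)"])
      show "(\<lambda>x. k x * of_real (bump i c d x)) \<in> borel_measurable ?M" for i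
        using integrable_mult_bump[OF k] by auto
      have [measurable]: "{c<..<d} \<in> sets ?M" 
        by (auto simp: sets_restrict_space_iff)
      show "(\<lambda>x. k x * of_real (indicator {c<..<d} x)) \<in> borel_measurable ?M"
        using meas by measurable
      show "AE x in ?M. (\<lambda>i. k x * of_real (bump i c d x)) \<longlonglongrightarrow> k x * of_real (indicator {c<..<d} x)"
        by (intro AE_I2 tendsto_intros bump_tendsto)
      show "AE x in ?M. norm (k x * of_real (bump i c d x)) \<le> norm (k x)" for i
        by (intro AE_I2) (simp add: norm_mult bump_bounds mult_left_le)
    qed (use k in auto)
    moreover have "(\<integral>x. k x * of_real (bump n c d x) \<partial>?M) = 0" for n
    proof -
      have "(\<integral>x. k x * of_real (bump n c d x) \<partial>lebesgue_on {a<..<b}) = (\<integral>x. k x * of_real (bump n c d x) \<partial>?M)"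
        using cd by (intro integral_lebesgue_on_restrict) (auto simp: bump_outside)
      then show ?thesis using z cd by simp
    qed
    ultimately have "(\<integral>x. k x * of_real (indicator {c<..<d} x) \<partial>?M) = 0"
      using LIMSEQ_unique[of "\<lambda>n. 0"] by auto
    moreover have "(\<integral>x. k x * of_real (indicator {c<..<d} x) \<partial>?M)
        = (\<integral>x. k x * of_real (indicator {c<..<d} x) \<partial>lebesgue_on {c<..<d})"
      by (intro integral_lebesgue_on_restrict) auto
    moreover have "\<dots> = (\<integral>x. k x \<partial>lebesgue_on {c<..<d})"
      by (rule Bochner_Integration.integral_cong) auto
    ultimately show ?thesis
      using k by (simp add: lebesgue_integral_eq_integral integral_open_interval_real
          integrable_lebesgue_on_Icc_iff_Ioo)
  qed
  have loc: "AE x in lebesgue. x \<in> {c<..<d} \<longrightarrow> k x = 0" if cd: "a < c" "c < d" "d < b" for c d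
  proof -
    \<comment> \<open>Extension by zero gives a function that is integrable on every box, as the
      differentiation theorem requires.\<close>
    define kk where "kk x = (if x \<in> {c..d} then k x else 0)" for x
    have "kk integrable_on UNIV"
      unfolding kk_def integrable_restrict_UNIV using int cd by (simp add: integrable_on_lebesgue_on)
    then have "kk integrable_on cbox u v" for u v
      using integrable_on_subcbox by blast
    then obtain N where N: "negligible N"
      "\<And>x e. \<lbrakk>x \<notin> N; 0 < e\<rbrakk> \<Longrightarrow> \<exists>\<delta>>0. \<forall>h. 0 < h \<and> h < \<delta> \<longrightarrow>
          norm (integral (cbox x (x + h *\<^sub>R One)) kk /\<^sub>R h ^ DIM(real) - kk x) < e"
      using integrable_ccontinuous_explicit[of kk] by metis
    \<comment> \<open>If k x were nonzero, the averages of \<open>k\<close> over short intervals to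
      the right of x would come within |k x| of k x; but all these averages are 0.\<close>
    have "k x = 0" if x: "x \<notin> N" "x \<in> {c<..<d}" for x
    proof (rule ccontr)
      assume "k x \<noteq> 0"
      then obtain \<delta> where \<delta>: "\<delta> > 0" "\<And>h. 0 < h \<Longrightarrow> h < \<delta> \<Longrightarrow>
          norm (integral (cbox x (x + h *\<^sub>R One)) kk /\<^sub>R h ^ DIM(real) - kk x) < norm (k x)"
        using N(2)[OF x(1), of "norm (k x)"] by auto
      define h where "h = min (\<delta>/2) ((d - x)/2)"
      have h: "0 < h" "h < \<delta>" "x + h < d" using \<delta>(1) x by (auto simp: h_def min_def field_simps)
      have "integral {x..x+h} kk = integral {x..x+h} k"
        by (rule Henstock_Kurzweil_Integration.integral_cong) (use x h in \<open>auto simp: kk_def\<close>)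
      also have "\<dots> = 0" using zero[of x "x+h"] x h cd by auto
      finally show False using \<delta>(2)[OF h(1,2)] x by (simp add: kk_def)
    qed
    then show ?thesis
      by (intro AE_I'[of N]) (use N(1) in \<open>auto simp: negligible_iff_null_sets\<close>)
  qed
  \<comment> \<open>\<open>loc\<close> works only strictly inside the interval; countably many such
    intervals exhaust it.\<close>
  have "AE x in lebesgue. x \<in> {a + inverse (real (Suc n))<..<b - inverse (real (Suc n))} \<longrightarrow> k x = 0" for n
  proof (cases "a + inverse (real (Suc n)) < b - inverse (real (Suc n))")
    case True
    then show ?thesis by (intro loc) (auto simp: field_simps)
  qed auto
  then have "AE x in lebesgue. \<forall>n. x \<in> {a + inverse (real (Suc n))<..<b - inverse (real (Suc n))} \<longrightarrow> k x = 0"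
    by (simp only: AE_all_countable) blast
  then have "AE x in lebesgue. x \<in> {a<..<b} \<longrightarrow> k x = 0"
  proof (eventually_elim, intro impI)
    fix x assume k: "\<forall>n. x \<in> {a + inverse (real (Suc n))<..<b - inverse (real (Suc n))} \<longrightarrow> k x = 0"
      and x: "x \<in> {a<..<b}"
    obtain n where "inverse (real (Suc n)) < min (x - a) (b - x)"
      using reals_Archimedean[of "min (x - a) (b - x)"] x by auto
    then have "x \<in> {a + inverse (real (Suc n))<..<b - inverse (real (Suc n))}"
      by (simp del: of_nat_Suc)
    with k show "k x = 0" by blast
  qed
  then show ?thesis by (simp add: AE_restrict_space_iff)
qed

lemma bump_integral_pos:
  assumes "c < d"
  shows "integral {c..d} (bump n c d) > 0"
proof -
  have cont: "continuous_on {c..d} (bump n c d)"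
  proof -
    have "continuous_on {c..d} (\<lambda>x. Re (complex_of_real (bump n c d x)))"
      by (intro continuous_intros flat_alg_continuous bump_alg)
    then show ?thesis by simp
  qed
  have "(c + d) / 2 \<in> {c..d}" using assms by auto
  moreover have "bump n c d ((c + d) / 2) \<noteq> 0" using assms bump_pos[of c "(c+d)/2" d n] by simp
  ultimately have "integral {c..d} (bump n c d) \<noteq> 0"
    using integral_eq_0_iff[OF cont assms] bump_bounds(1) by blast
  moreover have "integral {c..d} (bump n c d) \<ge> 0"
    by (intro Henstock_Kurzweil_Integration.integral_nonneg integrable_continuous_real cont bump_bounds)
  ultimately show ?thesis by simp
qed

text \<open>The constant is the mean of \<open>h\<close> weighted by one fixed bump. Any other bump
  minus the multiple of the fixed one with the same integral has mean zero, so it is the derivative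
  of a test function and \<open>h\<close> annihilates it. Thus h - C annihilates every bump.\<close>

lemma du_Bois_Reymond:
  assumes ab: "a < b" and h: "integrable (lebesgue_on {a<..<b}) h"
    and z: "\<And>\<phi>. test_function {a<..<b} \<phi> \<Longrightarrow>
      (\<integral>x. h x * vector_derivative \<phi> (at x) \<partial>lebesgue_on {a<..<b}) = 0"
  obtains C where "AE x in lebesgue_on {a<..<b}. h x = C"
proof -
  let ?M = "lebesgue_on {a<..<b}"
  define c0 d0 where "c0 = (2 * a + b) / 3" and "d0 = (a + 2 * b) / 3"
  have cd0: "a < c0" "c0 < d0" "d0 < b" using ab by (auto simp: c0_def d0_def)
  define s where "s n c d = integral {c..d} (bump n c d)" for n c d
  have s0: "s 0 c0 d0 > 0" unfolding s_def using cd0 by (intro bump_integral_pos)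
  define C where "C = (\<integral>x. h x * of_real (bump 0 c0 d0 x) \<partial>?M) / of_real (s 0 c0 d0)"
  have lint: "(\<integral>x. complex_of_real (bump n c d x) \<partial>?M) = of_real (s n c d)" if "a < c" "c < d" "d < b" for n c d
  proof -
    have "(\<integral>x. complex_of_real (bump n c d x) \<partial>?M) = (\<integral>x. complex_of_real (bump n c d x) \<partial>lebesgue_on {c..d})"
      using that by (intro integral_lebesgue_on_restrict) (auto simp: bump_outside)
    also have "\<dots> = integral {c..d} (\<lambda>x. complex_of_real (bump n c d x))"
      by (intro lebesgue_integral_eq_integral)
        (auto intro!: absolutely_integrable_imp_integrable absolutely_integrable_continuous_real flat_alg_continuous bump_alg)
    also have "\<dots> = of_real (s n c d)"
    proof -
      have "(bump n c d) integrable_on {c..d}"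
        using bump_integral_pos[OF that(2), of n] not_integrable_integral by force
      then have "(bump n c d has_integral s n c d) {c..d}" unfolding s_def by (rule integrable_integral)
      then show ?thesis using has_integral_of_real by (intro integral_unique) blast
    qed
    finally show ?thesis .
  qed
  have hb: "integrable ?M (\<lambda>x. h x * of_real (bump n c d x))" for n c d
    by (rule integrable_mult_bump[OF h])
  have fin: "finite_measure ?M" by (simp add: finite_measure_lebesgue_on)
  have one: "integrable ?M (\<lambda>x. 1 :: complex)" using fin by (simp add: finite_measure.integrable_const)
  have bint: "integrable ?M (\<lambda>x. complex_of_real (bump n c d x))" for n c d
    using integrable_mult_bump[OF one] by simp
  have key: "(\<integral>x. (h x - C) * of_real (bump n c d x) \<partial>?M) = 0" if cd: "a < c" "c < d" "d < b" for n c d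
  proof -
    define r where "r = s n c d / s 0 c0 d0"
    define \<theta> where "\<theta> x = complex_of_real (bump n c d x) + of_real (-r) * of_real (bump 0 c0 d0 x)" for x
    have alg: "flat_alg \<theta>"
      unfolding \<theta>_def by (intro flat_alg.add flat_alg_cmult bump_alg)
    \<comment> \<open>The hull of the two supports, still strictly inside the interval; the
      antiderivative has to be built over one compact interval.\<close>
    define c1 d1 where "c1 = min c c0" and "d1 = max d d0"
    have cd1: "a < c1" "c1 \<le> d1" "d1 < b" "{c..d} \<subseteq> {c1..d1}" "{c0..d0} \<subseteq> {c1..d1}"
      using cd cd0 by (auto simp: c1_def d1_def)
    have supp: "\<theta> x = 0" if "x \<notin> {c1..d1}" for x
    proof -
      have "x \<notin> {c<..<d}" "x \<notin> {c0<..<d0}" using that by (auto simp: c1_def d1_def)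
      then show ?thesis by (simp add: \<theta>_def bump_outside)
    qed
    have tint: "integrable ?M \<theta>" unfolding \<theta>_def using bint by simp
    have "integral {c1..d1} \<theta> = (\<integral>x. \<theta> x \<partial>lebesgue_on {c1..d1})"
      by (intro lebesgue_integral_eq_integral[symmetric] integrable_lebesgue_on_subset[OF tint])
         (use cd1 in auto)
    also have "\<dots> = (\<integral>x. \<theta> x \<partial>?M)"
      using cd1 supp by (intro integral_lebesgue_on_restrict[symmetric]) auto
    also have "\<dots> = of_real (s n c d) + of_real (-r) * of_real (s 0 c0 d0)"
      unfolding \<theta>_def using bint lint cd cd0 by simp
    also have "\<dots> = 0" using s0 by (simp add: r_def)
    finally have "integral {c1..d1} \<theta> = 0" .
    then obtain \<phi> where \<phi>: "test_function {a<..<b} \<phi>" "\<And>x. (\<phi> has_vector_derivative \<theta> x) (at x)"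
      by (rule test_function_antiderivative[OF alg supp, where I = "{a<..<b}", rotated 3]) (use cd1 in auto)
    have "vector_derivative \<phi> (at x) = \<theta> x" for x
      using \<phi>(2) by (simp add: vector_derivative_at)
    with z[OF \<phi>(1)] have "(\<integral>x. h x * \<theta> x \<partial>?M) = 0" by simp
    moreover have "h x * \<theta> x = h x * of_real (bump n c d x) + of_real (-r) * (h x * of_real (bump 0 c0 d0 x))" for x
      by (simp add: \<theta>_def algebra_simps)
    ultimately have "(\<integral>x. h x * of_real (bump n c d x) \<partial>?M) + of_real (-r) * (\<integral>x. h x * of_real (bump 0 c0 d0 x) \<partial>?M) = 0"
      using hb by simp
    moreover have "of_real r * (\<integral>x. h x * of_real (bump 0 c0 d0 x) \<partial>?M) = C * of_real (s n c d)"
      unfolding C_def r_def by simp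
    moreover have "(\<integral>x. (h x - C) * of_real (bump n c d x) \<partial>?M)
       = (\<integral>x. h x * of_real (bump n c d x) \<partial>?M) - C * of_real (s n c d)"
      using hb bint lint[OF cd] by (simp add: left_diff_distrib)
    ultimately show ?thesis by simp
  qed
  have hC: "integrable ?M (\<lambda>x. h x - C)"
    using h fin by (simp add: finite_measure.integrable_const)
  have "AE x in ?M. h x - C = 0"
  proof (rule AE_zero_if_bump_integrals_zero)
    show "locally_integrable_on (\<lambda>x. h x - C) {a<..<b}"
      unfolding locally_integrable_on_def
      by (intro allI impI integrable_lebesgue_on_subset[OF hC]) (auto dest: borel_compact)
  qed (rule key)
  then show ?thesis by (intro that[of C]) simp
qed

section \<open>Weak derivatives and primitives\<close>

lemma integrable_mult_continuous:
  fixes g H :: "real \<Rightarrow> complex"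
  assumes g: "integrable (lebesgue_on {a..b}) g" and H: "continuous_on {a..b} H"
  shows "integrable (lebesgue_on {a..b}) (\<lambda>x. g x * H x)"
proof -
  have "bilinear ((*) :: complex \<Rightarrow> _)"
    by (simp add: bilinear_conv_bounded_bilinear bounded_bilinear_mult)
  then have "(\<lambda>x. H x * g x) absolutely_integrable_on {a..b}"
    by (rule absolutely_integrable_bounded_measurable_product)
      (use g in \<open>auto simp: integrable_lebesgue_on_iff intro: continuous_imp_measurable_on_sets_lebesgue H
          compact_imp_bounded compact_continuous_image\<close>)
  then show ?thesis by (simp add: integrable_lebesgue_on_iff mult.commute)
qed

text \<open>Fubini for \<open>(x, y) \<mapsto> g y * h x\<close> on the triangle \<open>y < x\<close>; \<open>g\<close> is merely integrable, so
  the library's integration by parts does not apply.\<close>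
lemma integral_parts_indefinite:
  fixes g h H :: "real \<Rightarrow> complex"
  assumes ab: "a \<le> b" and g: "integrable (lebesgue_on {a..b}) g"
    and H: "\<And>x. x \<in> {a..b} \<Longrightarrow> (H has_vector_derivative h x) (at x within {a..b})"
    and h: "continuous_on {a..b} h"
  shows "integral {a..b} (\<lambda>x. integral {a..x} g * h x)
       = integral {a..b} g * H b - integral {a..b} (\<lambda>x. g x * H x)"
proof -
  let ?M = "lebesgue_on {a..b}"
  interpret finite_measure ?M by (simp add: finite_measure_lebesgue_on)
  interpret P: pair_sigma_finite ?M ?M by unfold_locales
  have contH: "continuous_on {a..b} H"
    using H by (rule continuous_on_vector_derivative)
  have idm [measurable]: "(\<lambda>x. x) \<in> measurable ?M borel"
    by (intro measurable_restrict_space1 measurable_completion) simp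
  have gm [measurable]: "g \<in> borel_measurable ?M" using g by auto
  have hm [measurable]: "h \<in> borel_measurable ?M"
    using continuous_imp_measurable_on_sets_lebesgue[OF h] by simp
  obtain K where K: "\<And>x. x \<in> {a..b} \<Longrightarrow> norm (h x) \<le> K"
    using compact_imp_bounded[OF compact_continuous_image[OF h compact_Icc]]
    unfolding bounded_iff by (auto simp del: atLeastAtMost_iff)
  define F where "F x y = (if y < x then g y * h x else 0)" for x y
  have Fm [measurable]: "case_prod F \<in> borel_measurable (?M \<Otimes>\<^sub>M ?M)"
    unfolding F_def case_prod_beta by measurable
  have gh: "integrable ?M (\<lambda>y. g y * h x)" for x
    using g by simp
  have gF: "integrable ?M (F x)" if "x \<in> {a..b}" for x
  proof (rule Bochner_Integration.integrable_bound[OF gh[of x]])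
    show "F x \<in> borel_measurable ?M" unfolding F_def by measurable
  qed (auto simp: F_def)
  have "integrable (?M \<Otimes>\<^sub>M ?M) (case_prod F)"
  proof (rule P.Fubini_integrable[OF Fm])
    show "AE x in ?M. integrable ?M (\<lambda>y. case_prod F (x, y))"
      by (intro AE_I2) (use gF in simp)
    show "integrable ?M (\<lambda>x. \<integral>y. norm (case_prod F (x, y)) \<partial>?M)"
    proof (rule Bochner_Integration.integrable_bound[of _ "\<lambda>x. (\<integral>y. norm (g y) \<partial>?M) * K"])
      show "AE x in ?M. norm (\<integral>y. norm (case_prod F (x, y)) \<partial>?M) \<le> norm ((\<integral>y. norm (g y) \<partial>?M) * K)"
      proof (intro AE_I2)
        fix x assume "x \<in> space ?M"
        then have x: "x \<in> {a..b}" by simp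
        have K0: "K \<ge> 0" using K[OF x] norm_ge_zero order_trans by blast
        have "(\<integral>y. norm (F x y) \<partial>?M) \<le> (\<integral>y. norm (g y) * K \<partial>?M)"
        proof (rule integral_mono)
          show "norm (F x y) \<le> norm (g y) * K" for y
            using K[OF x] K0 by (auto simp: F_def norm_mult intro!: mult_left_mono)
        qed (use gF[OF x] g in auto)
        then show "norm (\<integral>y. norm (case_prod F (x, y)) \<partial>?M) \<le> norm ((\<integral>y. norm (g y) \<partial>?M) * K)"
          using K0 by simp
      qed
    qed (simp_all)
  qed
  from P.Fubini_integral[OF this]
  have swap: "(\<integral>y. (\<integral>x. F x y \<partial>?M) \<partial>?M) = (\<integral>x. (\<integral>y. F x y \<partial>?M) \<partial>?M)" .
  \<comment> \<open>Integrating out y leaves the primitive of \<open>g\<close>; integrating out x,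
    in \<open>inner2\<close>, leaves the increment of \<open>H\<close> from y to b. Equality of the
    two iterated integrals is the claim.\<close>
  have inner1: "(\<integral>y. F x y \<partial>?M) = integral {a..x} g * h x" if x: "x \<in> {a..b}" for x
  proof -
    have "(\<integral>y. F x y \<partial>?M) = (\<integral>y. F x y \<partial>lebesgue_on {a..<x})"
      by (intro integral_lebesgue_on_restrict) (use x in \<open>auto simp: F_def\<close>)
    also have "\<dots> = (\<integral>y. g y * h x \<partial>lebesgue_on {a..<x})"
      by (rule Bochner_Integration.integral_cong) (auto simp: F_def)
    also have "\<dots> = integral {a..<x} (\<lambda>y. g y * h x)"
      by (intro lebesgue_integral_eq_integral integrable_lebesgue_on_subset[OF gh]) (use x in auto)
    also have "\<dots> = integral {a..x} (\<lambda>y. g y * h x)"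
      by (rule integral_spike_set; rule negligible_subset[of "{x}"]; force)
    finally show ?thesis by simp
  qed
  have inner2: "(\<integral>x. F x y \<partial>?M) = g y * (H b - H y)" if y: "y \<in> {a..b}" for y
  proof -
    have hi: "integrable ?M h"
      by (simp add: absolutely_integrable_continuous_real absolutely_integrable_imp_integrable h)
    have "(\<integral>x. F x y \<partial>?M) = (\<integral>x. F x y \<partial>lebesgue_on {y<..b})"
      by (intro integral_lebesgue_on_restrict) (use y in \<open>auto simp: F_def\<close>)
    also have "\<dots> = (\<integral>x. g y * h x \<partial>lebesgue_on {y<..b})"
      by (rule Bochner_Integration.integral_cong) (auto simp: F_def)
    also have "\<dots> = g y * (\<integral>x. h x \<partial>lebesgue_on {y<..b})"
      by simp
    also have "(\<integral>x. h x \<partial>lebesgue_on {y<..b}) = integral {y<..b} h"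
      by (intro lebesgue_integral_eq_integral integrable_lebesgue_on_subset[OF hi]) (use y in auto)
    also have "\<dots> = integral {y..b} h"
      by (rule integral_spike_set; rule negligible_subset[of "{y}"]; force)
    also have "(h has_integral (H b - H y)) {y..b}"
      by (rule fundamental_theorem_of_calculus)
        (use y in \<open>auto intro: has_vector_derivative_within_subset[OF H]\<close>)
    then have "integral {y..b} h = H b - H y" by (rule integral_unique)
    finally show ?thesis .
  qed
  have gH: "integrable ?M (\<lambda>y. g y * H y)"
    by (rule integrable_mult_continuous[OF g contH])
  have "(\<integral>x. integral {a..x} g * h x \<partial>?M) = (\<integral>y. g y * (H b - H y) \<partial>?M)"
  proof -
    have "(\<integral>x. integral {a..x} g * h x \<partial>?M) = (\<integral>x. (\<integral>y. F x y \<partial>?M) \<partial>?M)"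
      by (rule Bochner_Integration.integral_cong) (use inner1 in auto)
    moreover have "(\<integral>y. (\<integral>x. F x y \<partial>?M) \<partial>?M) = (\<integral>y. g y * (H b - H y) \<partial>?M)"
      by (rule Bochner_Integration.integral_cong) (use inner2 in auto)
    ultimately show ?thesis using swap by simp
  qed
  also have "\<dots> = (\<integral>y. g y * H b \<partial>?M) - (\<integral>y. g y * H y \<partial>?M)"
    using g gH by (simp add: right_diff_distrib)
  also have "\<dots> = integral {a..b} g * H b - integral {a..b} (\<lambda>x. g x * H x)"
    using g gH by (simp add: lebesgue_integral_eq_integral)
  also have "(\<integral>x. integral {a..x} g * h x \<partial>?M) = integral {a..b} (\<lambda>x. integral {a..x} g * h x)"
  proof -
    have "continuous_on {a..b} (\<lambda>x. integral {a..x} g)"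
      using g by (intro indefinite_integral_continuous_1) (simp add: integrable_on_lebesgue_on)
    then have "continuous_on {a..b} (\<lambda>x. integral {a..x} g * h x)"
      by (intro continuous_intros h)
    then show ?thesis
      by (intro lebesgue_integral_eq_integral)
        (auto intro!: absolutely_integrable_imp_integrable absolutely_integrable_continuous_real)
  qed
  finally show ?thesis .
qed

lemma test_functionD:
  assumes "test_function I \<phi>"
  obtains \<phi>' where "\<And>x. (\<phi> has_vector_derivative \<phi>' x) (at x)" "continuous_on UNIV \<phi>'"
    "\<And>x. vector_derivative \<phi> (at x) = \<phi>' x" "\<And>x. x \<notin> I \<Longrightarrow> \<phi> x = 0"
proof -
  obtain D K where D: "D 0 = \<phi>" "\<And>n x. (D n has_vector_derivative D (Suc n) x) (at x)"
    and K: "K \<subseteq> I" "\<And>x. x \<notin> K \<Longrightarrow> \<phi> x = 0"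
    using assms unfolding test_function_def by blast
  have 1: "(\<phi> has_vector_derivative D 1 x) (at x)" for x using D(2)[of 0 x] D(1) by simp
  show ?thesis
  proof (rule that[of "D 1"])
    show "continuous_on UNIV (D 1)"
      using D(2)[of 1] by (meson continuous_at_imp_continuous_on has_vector_derivative_continuous)
    show "vector_derivative \<phi> (at x) = D 1 x" for x using 1 vector_derivative_at by blast
  qed (use 1 K in auto)
qed

text \<open>The primitive of \<open>g\<close> pairs with test functions exactly as \<open>u\<close>
  does, so \<open>u\<close> minus this primitive annihilates all derivatives of test functions and
  is constant.\<close>

lemma weak_derivative_imp_indefinite_integral:
  assumes ab: "a < b" and u: "integrable (lebesgue_on {a<..<b}) u"
    and g: "integrable (lebesgue_on {a<..<b}) g" and w: "has_weak_derivative {a<..<b} u g"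
  obtains C where "AE x in lebesgue_on {a<..<b}. u x = C + integral {a..x} g"
proof -
  let ?I = "{a<..<b}" let ?M = "lebesgue_on {a<..<b}"
  have u': "integrable (lebesgue_on {a..b}) u" and g': "integrable (lebesgue_on {a..b}) g"
    using u g by (simp_all add: integrable_lebesgue_on_Icc_iff_Ioo)
  define G where "G x = integral {a..x} g" for x
  have contG: "continuous_on {a..b} G"
    unfolding G_def using g' by (intro indefinite_integral_continuous_1) (simp add: integrable_on_lebesgue_on)
  have cint: "integrable ?M f" if "continuous_on {a..b} f" for f :: "real \<Rightarrow> complex"
    using that by (subst integrable_lebesgue_on_Icc_iff_Ioo[symmetric])
      (auto intro!: absolutely_integrable_imp_integrable absolutely_integrable_continuous_real)
  have "integrable ?M (\<lambda>x. u x - G x)" using u cint[OF contG] by simp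
  then obtain C where C: "AE x in ?M. u x - G x = C"
  proof (rule du_Bois_Reymond[OF ab])
    fix \<phi> assume t: "test_function ?I \<phi>"
    obtain \<phi>' where \<phi>': "\<And>x. (\<phi> has_vector_derivative \<phi>' x) (at x)" "continuous_on UNIV \<phi>'"
      and eq: "\<And>x. vector_derivative \<phi> (at x) = \<phi>' x" and out: "\<And>x. x \<notin> ?I \<Longrightarrow> \<phi> x = 0"
      using test_functionD[OF t] by metis
    have cont': "continuous_on {a..b} \<phi>'" using \<phi>'(2) continuous_on_subset by blast
    have cont: "continuous_on {a..b} \<phi>"
      using \<phi>'(1) by (meson continuous_at_imp_continuous_on has_vector_derivative_continuous)
    have i1: "integrable ?M (\<lambda>x. u x * \<phi>' x)"
      using integrable_mult_continuous[OF u' cont'] by (simp add: integrable_lebesgue_on_Icc_iff_Ioo)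
    have i2: "integrable ?M (\<lambda>x. G x * \<phi>' x)"
      by (intro cint continuous_intros contG cont')
    have i3: "integrable ?M (\<lambda>x. g x * \<phi> x)"
      using integrable_mult_continuous[OF g' cont] by (simp add: integrable_lebesgue_on_Icc_iff_Ioo)
    \<comment> \<open>Both boundary terms vanish: the test function is 0 at b, and the primitive
      starts from 0 at a.\<close>
    have "(\<integral>x. G x * \<phi>' x \<partial>?M) = integral {a..b} (\<lambda>x. G x * \<phi>' x)"
      using i2 by (simp add: lebesgue_integral_eq_integral integral_open_interval_real)
    also have "\<dots> = integral {a..b} g * \<phi> b - integral {a..b} (\<lambda>x. g x * \<phi> x)"
      unfolding G_def
      by (rule integral_parts_indefinite) (use ab g' cont' \<phi>'(1) in \<open>auto intro: has_vector_derivative_at_within\<close>)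
    also have "\<dots> = - (\<integral>x. g x * \<phi> x \<partial>?M)"
      using out[of b] i3 by (simp add: lebesgue_integral_eq_integral integral_open_interval_real)
    also have "\<dots> = (\<integral>x. u x * \<phi>' x \<partial>?M)"
      using w t unfolding has_weak_derivative_def eq[symmetric] by simp
    finally show "(\<integral>x. (u x - G x) * vector_derivative \<phi> (at x) \<partial>?M) = 0"
      using i1 i2 by (simp add: eq left_diff_distrib)
  qed
  show ?thesis
    by (rule that[of C]) (use C in eventually_elim, simp add: G_def algebra_simps)
qed

text \<open>\<open>weak_deriv\<close> is a Hilbert choice, so norms of it are meaningful only
  through this uniqueness. Bumps suffice as test functions.\<close>

lemma weak_derivative_unique:
  assumes w: "has_weak_derivative {a<..<b} u g1" "has_weak_derivative {a<..<b} u g2"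
  shows "AE x in lebesgue_on {a<..<b}. g1 x = g2 x"
proof -
  let ?M = "lebesgue_on {a<..<b}"
  have li: "locally_integrable_on g1 {a<..<b}" "locally_integrable_on g2 {a<..<b}"
    using w by (auto simp: has_weak_derivative_def)
  have "AE x in ?M. g1 x - g2 x = 0"
  proof (rule AE_zero_if_bump_integrals_zero)
    show "locally_integrable_on (\<lambda>x. g1 x - g2 x) {a<..<b}"
      using li unfolding locally_integrable_on_def by auto
    fix n c d assume cd: "a < c" "c < d" "d < b"
    have sub: "{c..d} \<subseteq> {a<..<b}" using cd by auto
    have t: "test_function {a<..<b} (\<lambda>x. complex_of_real (bump n c d x))"
      using test_function_bump[OF sub] .
    have i: "integrable (lebesgue_on {c..d}) g1" "integrable (lebesgue_on {c..d}) g2"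
      using li sub compact_Icc unfolding locally_integrable_on_def by blast+
    \<comment> \<open>\<open>g1\<close> and \<open>g2\<close> are only locally integrable, so the
      integral is moved to the compact support of the bump before the difference is split.\<close>
    have r: "(\<integral>x. f x * of_real (bump n c d x) \<partial>?M) = (\<integral>x. f x * of_real (bump n c d x) \<partial>lebesgue_on {c..d})"
      for f :: "real \<Rightarrow> complex"
      by (intro integral_lebesgue_on_restrict) (use sub in \<open>auto simp: bump_outside\<close>)
    have "(\<integral>x. g1 x * of_real (bump n c d x) \<partial>?M) = (\<integral>x. g2 x * of_real (bump n c d x) \<partial>?M)"
      using w t unfolding has_weak_derivative_def by (metis minus_equation_iff)
    then show "(\<integral>x. (g1 x - g2 x) * of_real (bump n c d x) \<partial>?M) = 0"
      unfolding r using i[THEN integrable_mult_bump, of n c d] by (simp add: left_diff_distrib)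
  qed
  then show ?thesis by simp
qed

section \<open>Wirtinger's inequality\<close>

text \<open>The cotangent term grows like 1/t. The square of a Lipschitz function that vanishes at
  the end point is O(t^2), which is enough to kill the boundary terms in the Dirichlet
  inequality.\<close>

lemma cot_times_square_tendsto_0:
  fixes c :: real
  assumes "c > 0"
  shows "((\<lambda>t. c * cot (c * t) * t\<^sup>2) \<longlongrightarrow> 0) (at_right 0)"
  unfolding cot_def using assms by real_asymp

text \<open>Integrate \<open>(v' - c cot (c (x - a)) v)\<^sup>2 \<ge> 0\<close>: up to an exact derivative it equals
  \<open>v'\<^sup>2 - c\<^sup>2 v\<^sup>2\<close>.\<close>
lemma wirtinger_dirichlet_real:
  fixes v v' :: "real \<Rightarrow> real"
  assumes ab: "a < b" and v: "\<And>x. x \<in> {a..b} \<Longrightarrow> (v has_real_derivative v' x) (at x within {a..b})"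
    and v': "continuous_on {a..b} v'" and va: "v a = 0" and vb: "v b = 0"
  shows "(pi / (b - a))\<^sup>2 * integral {a..b} (\<lambda>x. (v x)\<^sup>2) \<le> integral {a..b} (\<lambda>x. (v' x)\<^sup>2)"
proof -
  \<comment> \<open>With this c, sin (c (x - a)) is the first Dirichlet eigenfunction, positive
    inside and zero at both ends; c cot (c (x - a)) is its logarithmic derivative.\<close>
  define c where "c = pi / (b - a)"
  have c: "c > 0" using ab by (simp add: c_def)
  have cb: "c * (b - a) = pi" using ab by (simp add: c_def)
  have contv: "continuous_on {a..b} v"
    using v by (meson DERIV_continuous continuous_on_eq_continuous_within)
  obtain B where B: "\<And>x. x \<in> {a..b} \<Longrightarrow> norm (v' x) \<le> B"
    using compact_imp_bounded[OF compact_continuous_image[OF v' compact_Icc]]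
    unfolding bounded_iff by (auto simp del: atLeastAtMost_iff)
  have lip: "\<bar>v x - v y\<bar> \<le> B * \<bar>x - y\<bar>" if "x \<in> {a..b}" "y \<in> {a..b}" for x y
    using field_differentiable_bound[of "{a..b}" v v' B x y] v B that by (simp add: real_norm_def)
  \<comment> \<open>The primitive of the exact derivative. The cotangent is unbounded at both ends,
    but \<open>v\<close> vanishes there at least linearly, so \<open>K\<close> still tends to
    0.\<close>
  define K where "K x = c * cot (c * (x - a)) * (v x)\<^sup>2" for x
  have near_a: "norm (K x) \<le> B\<^sup>2 * norm (c * cot (c * (x - a)) * (x - a)\<^sup>2)" if "x \<in> {a..b}" for x
  proof -
    have "\<bar>v x\<bar> \<le> B * \<bar>x - a\<bar>" using lip[OF that, of a] ab va by simp
    then have "(v x)\<^sup>2 \<le> B\<^sup>2 * (x - a)\<^sup>2"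
      by (metis abs_ge_zero power2_abs power_mono power_mult_distrib)
    then have "\<bar>c * cot (c * (x - a))\<bar> * (v x)\<^sup>2 \<le> \<bar>c * cot (c * (x - a))\<bar> * (B\<^sup>2 * (x - a)\<^sup>2)"
      by (rule mult_left_mono) simp
    then show ?thesis by (simp add: K_def abs_mult mult_ac)
  qed
  \<comment> \<open>Since c (b - a) = pi, reflection turns the right end into the left end.\<close>
  have cot_refl: "cot (c * (x - a)) = - cot (c * (b - x))" for x
  proof -
    have "c * (x - a) = pi - c * (b - x)" using cb by (simp add: algebra_simps)
    then show ?thesis by (simp add: cot_def)
  qed
  have near_b: "norm (K x) \<le> B\<^sup>2 * norm (c * cot (c * (b - x)) * (b - x)\<^sup>2)" if "x \<in> {a..b}" for x
  proof -
    have "\<bar>v x\<bar> \<le> B * \<bar>b - x\<bar>" using lip[OF that, of b] ab vb by (simp add: abs_minus_commute)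
    then have "(v x)\<^sup>2 \<le> B\<^sup>2 * (b - x)\<^sup>2"
      by (metis abs_ge_zero power2_abs power_mono power_mult_distrib)
    then have "\<bar>c * cot (c * (b - x))\<bar> * (v x)\<^sup>2 \<le> \<bar>c * cot (c * (b - x))\<bar> * (B\<^sup>2 * (b - x)\<^sup>2)"
      by (rule mult_left_mono) simp
    then show ?thesis by (simp add: K_def cot_refl abs_mult mult_ac)
  qed
  have Ka: "(K \<longlongrightarrow> 0) (at_right a)"
  proof (rule Lim_null_comparison)
    show "\<forall>\<^sub>F x in at_right a. norm (K x) \<le> B\<^sup>2 * norm (c * cot (c * (x - a)) * (x - a)\<^sup>2)"
      unfolding eventually_at_right_field using near_a ab by (intro exI[of _ b]) auto
    have "((\<lambda>x. c * cot (c * (x - a)) * (x - a)\<^sup>2) \<longlongrightarrow> 0) (at_right a)"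
      using cot_times_square_tendsto_0[OF c] by (subst filterlim_at_right_to_0) simp
    then show "((\<lambda>x. B\<^sup>2 * norm (c * cot (c * (x - a)) * (x - a)\<^sup>2)) \<longlongrightarrow> 0) (at_right a)"
      by (intro tendsto_mult_right_zero tendsto_norm_zero)
  qed
  have Kb: "(K \<longlongrightarrow> 0) (at_left b)"
  proof (rule Lim_null_comparison)
    show "\<forall>\<^sub>F x in at_left b. norm (K x) \<le> B\<^sup>2 * norm (c * cot (c * (b - x)) * (b - x)\<^sup>2)"
      unfolding eventually_at_left_field using near_b ab by (intro exI[of _ a]) auto
    have "((\<lambda>x. c * cot (c * (b - x)) * (b - x)\<^sup>2) \<longlongrightarrow> 0) (at_left b)"
    proof (rule filterlim_compose[OF cot_times_square_tendsto_0[OF c]])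
      show "filterlim (\<lambda>x. b - x) (at_right 0) (at_left b)"
        unfolding filterlim_at by (auto simp: eventually_at_left_field intro!: tendsto_eq_intros exI[of _ "b - 1"])
    qed
    then show "((\<lambda>x. B\<^sup>2 * norm (c * cot (c * (b - x)) * (b - x)\<^sup>2)) \<longlongrightarrow> 0) (at_left b)"
      by (intro tendsto_mult_right_zero tendsto_norm_zero)
  qed
  have sin_pos: "sin (c * (x - a)) > 0" if "x \<in> {a<..<b}" for x
  proof (rule sin_gt_zero)
    show "0 < c * (x - a)" using c that by simp
    have "c * (x - a) < c * (b - a)" using c that by simp
    then show "c * (x - a) < pi" using cb by simp
  qed
  have K': "(K has_real_derivative (v' x)\<^sup>2 - c\<^sup>2 * (v x)\<^sup>2 - (v' x - c * cot (c * (x - a)) * v x)\<^sup>2) (at x)"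
    if x: "x \<in> {a<..<b}" for x
  proof -
    have s: "sin (c * (x - a)) \<noteq> 0" using sin_pos[OF x] by simp
    have vx: "(v has_real_derivative v' x) (at x)"
      using v[of x] x by (simp add: at_within_Icc_at)
    have "((\<lambda>x. cot (c * (x - a))) has_real_derivative - inverse ((sin (c * (x - a)))\<^sup>2) * c) (at x)"
      by (rule DERIV_chain2[where g = "\<lambda>x. c * (x - a)", OF DERIV_cot[OF s]]) (auto intro!: derivative_eq_intros)
    then have "(K has_real_derivative (c * (- inverse ((sin (c * (x - a)))\<^sup>2) * c)) * (v x)\<^sup>2
         + c * cot (c * (x - a)) * (2 * v x * v' x)) (at x)"
      unfolding K_def using vx by (auto intro!: derivative_eq_intros simp: power2_eq_square)
    moreover have "inverse ((sin (c * (x - a)))\<^sup>2) = 1 + (cot (c * (x - a)))\<^sup>2"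
      using s sin_cos_squared_add[of "c * (x - a)"] by (simp add: cot_def field_simps)
    ultimately show ?thesis by (simp add: power2_eq_square algebra_simps)
  qed
  have "((\<lambda>x. (v' x)\<^sup>2 - c\<^sup>2 * (v x)\<^sup>2 - (v' x - c * cot (c * (x - a)) * v x)\<^sup>2) has_integral (K b - K a)) {a..b}"
  proof (rule fundamental_theorem_of_calculus_interior)
    \<comment> \<open>These values agree with the limits \<open>Ka\<close> and \<open>Kb\<close>, so
      \<open>K\<close> is continuous up to the ends and the interior form of the fundamental theorem
      applies.\<close>
    have "K a = 0" "K b = 0" by (simp_all add: K_def va vb)
    moreover have "K \<midarrow>x\<rightarrow> K x" if "a < x" "x < b" for x
      using DERIV_isCont[OF K'[of x]] that by (simp add: isCont_def)
    ultimately show "continuous_on {a..b} K"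
      using Ka Kb ab by (intro continuous_on_IccI) simp_all
  qed (use ab K' in \<open>auto simp: has_real_derivative_iff_has_vector_derivative\<close>)
  then have I1: "((\<lambda>x. (v' x)\<^sup>2 - c\<^sup>2 * (v x)\<^sup>2 - (v' x - c * cot (c * (x - a)) * v x)\<^sup>2) has_integral 0) {a..b}"
    by (simp add: K_def va vb)
  have i: "(\<lambda>x. (v' x)\<^sup>2) integrable_on {a..b}" "(\<lambda>x. (v x)\<^sup>2) integrable_on {a..b}"
    by (intro integrable_continuous_real continuous_intros v' contv)+
  have I2: "((\<lambda>x. (v' x)\<^sup>2 - c\<^sup>2 * (v x)\<^sup>2) has_integral
      (integral {a..b} (\<lambda>x. (v' x)\<^sup>2) - c\<^sup>2 * integral {a..b} (\<lambda>x. (v x)\<^sup>2))) {a..b}"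
    by (intro has_integral_diff has_integral_mult_right integrable_integral i)
  have "0 \<le> integral {a..b} (\<lambda>x. (v' x)\<^sup>2) - c\<^sup>2 * integral {a..b} (\<lambda>x. (v x)\<^sup>2)"
    by (rule has_integral_le[OF I1 I2]) simp
  then show ?thesis by (simp add: c_def)
qed

lemma wirtinger_dirichlet:
  fixes v v' :: "real \<Rightarrow> complex"
  assumes ab: "a < b" and v: "\<And>x. x \<in> {a..b} \<Longrightarrow> (v has_vector_derivative v' x) (at x within {a..b})"
    and v': "continuous_on {a..b} v'" and va: "v a = 0" and vb: "v b = 0"
  shows "(pi / (b - a))\<^sup>2 * integral {a..b} (\<lambda>x. (cmod (v x))\<^sup>2) \<le> integral {a..b} (\<lambda>x. (cmod (v' x))\<^sup>2)"
proof -
  have contv: "continuous_on {a..b} v"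
    using v by (rule continuous_on_vector_derivative)
  have re: "(pi / (b - a))\<^sup>2 * integral {a..b} (\<lambda>x. (Re (v x))\<^sup>2) \<le> integral {a..b} (\<lambda>x. (Re (v' x))\<^sup>2)"
    by (rule wirtinger_dirichlet_real)
      (use assms in \<open>auto intro!: continuous_intros
         simp: has_real_derivative_iff_has_vector_derivative has_vector_derivative_complex_iff\<close>)
  have im: "(pi / (b - a))\<^sup>2 * integral {a..b} (\<lambda>x. (Im (v x))\<^sup>2) \<le> integral {a..b} (\<lambda>x. (Im (v' x))\<^sup>2)"
    by (rule wirtinger_dirichlet_real)
      (use assms in \<open>auto intro!: continuous_intros
         simp: has_real_derivative_iff_has_vector_derivative has_vector_derivative_complex_iff\<close>)
  have split: "integral {a..b} (\<lambda>x. (cmod (f x))\<^sup>2) = integral {a..b} (\<lambda>x. (Re (f x))\<^sup>2) + integral {a..b} (\<lambda>x. (Im (f x))\<^sup>2)"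
    if "continuous_on {a..b} f" for f :: "real \<Rightarrow> complex"
    unfolding cmod_power2 using that
    by (intro Henstock_Kurzweil_Integration.integral_add integrable_continuous_real continuous_intros)
  show ?thesis using re im by (simp add: split[OF contv] split[OF v'] distrib_left)
qed

text \<open>The sharp constant is inherited from the Dirichlet case, applied to the primitive \<open>v\<close> of
  \<open>u\<close> minus its mean, by expanding \<open>\<integral> \<bar>g + c\<^sup>2 v\<bar>\<^sup>2 \<ge> 0\<close>.\<close>
lemma wirtinger_neumann:
  fixes g u :: "real \<Rightarrow> complex"
  assumes ab: "a < b" and g: "integrable (lebesgue_on {a..b}) g"
    and g2: "integrable (lebesgue_on {a..b}) (\<lambda>x. (cmod (g x))\<^sup>2)"
  obtains m where "integral {a..b} (\<lambda>x. (cmod (integral {a..x} g - m))\<^sup>2)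
      \<le> ((b - a) / pi)\<^sup>2 * integral {a..b} (\<lambda>x. (cmod (g x))\<^sup>2)"
proof -
  define G where "G x = integral {a..x} g" for x
  have contG: "continuous_on {a..b} G"
    unfolding G_def using g by (intro indefinite_integral_continuous_1) (simp add: integrable_on_lebesgue_on)
  \<comment> \<open>Subtracting the mean makes the primitive \<open>v\<close> of \<open>u\<close>
    vanish at b as well as at a; \<open>v\<close> is continuously differentiable although
    \<open>u\<close> only has an integrable derivative.\<close>
  define m where "m = integral {a..b} G / of_real (b - a)"
  define u where "u x = G x - m" for x
  have contu: "continuous_on {a..b} u" unfolding u_def by (intro continuous_intros contG)
  define v where "v x = integral {a..x} u" for x
  have v: "(v has_vector_derivative u x) (at x within {a..b})" if "x \<in> {a..b}" for x
    unfolding v_def by (rule integral_has_vector_derivative[OF contu that])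
  have contv: "continuous_on {a..b} v"
    using v by (rule continuous_on_vector_derivative)
  have va: "v a = 0" by (simp add: v_def)
  have vb: "v b = 0"
  proof -
    have "integral {a..b} u = integral {a..b} G - integral {a..b} (\<lambda>x. m)"
      unfolding u_def by (intro Henstock_Kurzweil_Integration.integral_diff integrable_continuous_real continuous_intros contG)
    also have "integral {a..b} (\<lambda>x. m) = integral {a..b} G"
      using ab by (simp add: m_def scaleR_conv_of_real)
    finally show ?thesis by (simp add: v_def)
  qed
  define c where "c = pi / (b - a)"
  have c: "c > 0" using ab by (simp add: c_def)
  have dir: "c\<^sup>2 * integral {a..b} (\<lambda>x. (cmod (v x))\<^sup>2) \<le> integral {a..b} (\<lambda>x. (cmod (u x))\<^sup>2)"
    unfolding c_def using wirtinger_dirichlet[OF ab v contu va vb] .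
  have cv: "((\<lambda>x. cnj (v x)) has_vector_derivative cnj (u x)) (at x within {a..b})" if "x \<in> {a..b}" for x
    using v[OF that] by (simp add: has_vector_derivative_cnj)
  have gv: "integrable (lebesgue_on {a..b}) (\<lambda>x. g x * cnj (v x))"
    by (rule integrable_mult_continuous[OF g]) (intro continuous_intros contv)
  have parts: "integral {a..b} (\<lambda>x. G x * cnj (u x)) = - integral {a..b} (\<lambda>x. g x * cnj (v x))"
    unfolding G_def
    by (subst integral_parts_indefinite[of a b g "\<lambda>x. cnj (v x)"]) (use ab g cv contu vb in \<open>auto intro!: continuous_intros\<close>)
  have uu: "of_real (integral {a..b} (\<lambda>x. (cmod (u x))\<^sup>2)) = - integral {a..b} (\<lambda>x. g x * cnj (v x))"
  proof -
    have "((\<lambda>x. (cmod (u x))\<^sup>2) has_integral integral {a..b} (\<lambda>x. (cmod (u x))\<^sup>2)) {a..b}"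
      by (intro integrable_integral integrable_continuous_real continuous_intros contu)
    then have "((\<lambda>x. complex_of_real ((cmod (u x))\<^sup>2)) has_integral of_real (integral {a..b} (\<lambda>x. (cmod (u x))\<^sup>2))) {a..b}"
      by (rule has_integral_of_real)
    then have "of_real (integral {a..b} (\<lambda>x. (cmod (u x))\<^sup>2)) = integral {a..b} (\<lambda>x. complex_of_real ((cmod (u x))\<^sup>2))"
      by (simp add: integral_unique)
    also have "\<dots> = integral {a..b} (\<lambda>x. G x * cnj (u x) - m * cnj (u x))"
      by (rule Henstock_Kurzweil_Integration.integral_cong) (simp add: complex_norm_square u_def algebra_simps del: of_real_power)
    also have "\<dots> = integral {a..b} (\<lambda>x. G x * cnj (u x)) - integral {a..b} (\<lambda>x. m * cnj (u x))"
      by (intro Henstock_Kurzweil_Integration.integral_diff integrable_continuous_real continuous_intros contG contu)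
    also have "integral {a..b} (\<lambda>x. m * cnj (u x)) = m * integral {a..b} (\<lambda>x. cnj (u x))"
      by (rule Henstock_Kurzweil_Integration.integral_mult_right)
    also have "((\<lambda>x. cnj (u x)) has_integral (cnj (v b) - cnj (v a))) {a..b}"
      using ab cv by (intro fundamental_theorem_of_calculus) auto
    then have "integral {a..b} (\<lambda>x. cnj (u x)) = 0" using va vb by (simp add: integral_unique)
    finally show ?thesis using parts by simp
  qed
  \<comment> \<open>Put N for the integral of |u|^2. By \<open>uu\<close> the cross term is -2 c^2
    N, and by \<open>dir\<close> the last term is at most c^2 N, which leaves c^2 N below the
    integral of |g|^2.\<close>
  have "0 \<le> integral {a..b} (\<lambda>x. (cmod (g x))\<^sup>2) + 2 * c\<^sup>2 * Re (integral {a..b} (\<lambda>x. g x * cnj (v x)))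
      + c\<^sup>2 * c\<^sup>2 * integral {a..b} (\<lambda>x. (cmod (v x))\<^sup>2)"
  proof (rule has_integral_nonneg)
    have I1: "((\<lambda>x. (cmod (g x))\<^sup>2) has_integral integral {a..b} (\<lambda>x. (cmod (g x))\<^sup>2)) {a..b}"
      using g2 by (intro integrable_integral) (simp add: integrable_on_lebesgue_on)
    have I2: "((\<lambda>x. Re (g x * cnj (v x))) has_integral Re (integral {a..b} (\<lambda>x. g x * cnj (v x)))) {a..b}"
      using gv by (intro has_integral_Re integrable_integral) (simp add: integrable_on_lebesgue_on)
    have I3: "((\<lambda>x. (cmod (v x))\<^sup>2) has_integral integral {a..b} (\<lambda>x. (cmod (v x))\<^sup>2)) {a..b}"
      by (intro integrable_integral integrable_continuous_real continuous_intros contv)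
    show "((\<lambda>x. (cmod (g x))\<^sup>2 + 2 * c\<^sup>2 * Re (g x * cnj (v x)) + c\<^sup>2 * c\<^sup>2 * (cmod (v x))\<^sup>2) has_integral
      (integral {a..b} (\<lambda>x. (cmod (g x))\<^sup>2) + 2 * c\<^sup>2 * Re (integral {a..b} (\<lambda>x. g x * cnj (v x)))
      + c\<^sup>2 * c\<^sup>2 * integral {a..b} (\<lambda>x. (cmod (v x))\<^sup>2))) {a..b}"
      by (intro has_integral_add has_integral_mult_right I1 I2 I3)
    fix x
    have "(cmod (g x))\<^sup>2 + 2 * c\<^sup>2 * Re (g x * cnj (v x)) + c\<^sup>2 * c\<^sup>2 * (cmod (v x))\<^sup>2
      = (Re (g x) + c\<^sup>2 * Re (v x))\<^sup>2 + (Im (g x) + c\<^sup>2 * Im (v x))\<^sup>2"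
      unfolding cmod_power2 by (simp add: power2_eq_square algebra_simps)
    then show "0 \<le> (cmod (g x))\<^sup>2 + 2 * c\<^sup>2 * Re (g x * cnj (v x)) + c\<^sup>2 * c\<^sup>2 * (cmod (v x))\<^sup>2"
      by simp
  qed
  moreover have "Re (integral {a..b} (\<lambda>x. g x * cnj (v x))) = - integral {a..b} (\<lambda>x. (cmod (u x))\<^sup>2)"
    using arg_cong[OF uu, of Re] by simp
  moreover have "c\<^sup>2 * (c\<^sup>2 * integral {a..b} (\<lambda>x. (cmod (v x))\<^sup>2)) \<le> c\<^sup>2 * integral {a..b} (\<lambda>x. (cmod (u x))\<^sup>2)"
    by (rule mult_left_mono[OF dir]) simp
  ultimately have "c\<^sup>2 * integral {a..b} (\<lambda>x. (cmod (u x))\<^sup>2) \<le> integral {a..b} (\<lambda>x. (cmod (g x))\<^sup>2)"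
    by (simp add: mult.assoc)
  then have "integral {a..b} (\<lambda>x. (cmod (u x))\<^sup>2) \<le> ((b - a) / pi)\<^sup>2 * integral {a..b} (\<lambda>x. (cmod (g x))\<^sup>2)"
    using ab by (simp add: c_def field_simps)
  then show ?thesis by (intro that[of m]) (simp add: u_def G_def)
qed

section \<open>Orthogonal projections onto finite-dimensional subspaces\<close>

lemma L2_measurable: "f \<in> L2 I \<Longrightarrow> f \<in> borel_measurable (lebesgue_on I)"
  by (simp add: L2_def)

lemma L2_integrable_square: "f \<in> L2 I \<Longrightarrow> integrable (lebesgue_on I) (\<lambda>x. (cmod (f x))\<^sup>2)"
  by (simp add: L2_def)

lemma L2_norm_nonneg: "0 \<le> L2_norm I f"
  by (simp add: L2_norm_def)

lemma L2_norm_square: "(L2_norm I f)\<^sup>2 = (\<integral>x. (cmod (f x))\<^sup>2 \<partial>lebesgue_on I)"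
  by (simp add: L2_norm_def)

lemma L2_zero: "(\<lambda>x. 0) \<in> L2 I"
  by (simp add: L2_def)

lemma L2_integrable_product:
  assumes "f \<in> L2 I" "g \<in> L2 I"
  shows "integrable (lebesgue_on I) (\<lambda>x. f x * cnj (g x))"
proof (rule Bochner_Integration.integrable_bound)
  show "integrable (lebesgue_on I) (\<lambda>x. (cmod (f x))\<^sup>2 + (cmod (g x))\<^sup>2)"
    using assms by (simp add: L2_integrable_square)
  have [measurable]: "f \<in> borel_measurable (lebesgue_on I)" "g \<in> borel_measurable (lebesgue_on I)"
    using assms by (simp_all add: L2_measurable)
  have "(\<lambda>x. cnj (g x)) \<in> borel_measurable (lebesgue_on I)"
    using borel_measurable_continuous_onI[OF continuous_on_cnj[OF continuous_on_id]]
    by measurable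
  then show "(\<lambda>x. f x * cnj (g x)) \<in> borel_measurable (lebesgue_on I)" by measurable
  show "AE x in lebesgue_on I. norm (f x * cnj (g x)) \<le> norm ((cmod (f x))\<^sup>2 + (cmod (g x))\<^sup>2)"
  proof (intro AE_I2)
    fix x
    have "2 * (cmod (f x) * cmod (g x)) \<le> (cmod (f x))\<^sup>2 + (cmod (g x))\<^sup>2" 
      using sum_squares_bound[of "cmod (f x)" "cmod (g x)"] by (simp add: mult.assoc)
    moreover have "0 \<le> cmod (f x) * cmod (g x)" by simp
    ultimately have "cmod (f x) * cmod (g x) \<le> (cmod (f x))\<^sup>2 + (cmod (g x))\<^sup>2" by linarith
    then show "norm (f x * cnj (g x)) \<le> norm ((cmod (f x))\<^sup>2 + (cmod (g x))\<^sup>2)"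
      by (simp add: norm_mult)
  qed
qed

lemma L2_cmult: "f \<in> L2 I \<Longrightarrow> (\<lambda>x. c * f x) \<in> L2 I"
  by (auto simp: L2_def norm_mult power_mult_distrib)

lemma L2_add:
  assumes "f \<in> L2 I" "g \<in> L2 I"
  shows "(\<lambda>x. f x + g x) \<in> L2 I"
proof -
  have [measurable]: "f \<in> borel_measurable (lebesgue_on I)" "g \<in> borel_measurable (lebesgue_on I)"
    using assms by (simp_all add: L2_measurable)
  have "integrable (lebesgue_on I) (\<lambda>x. (cmod (f x + g x))\<^sup>2)"
  proof (rule Bochner_Integration.integrable_bound)
    show "integrable (lebesgue_on I) (\<lambda>x. 2 * (cmod (f x))\<^sup>2 + 2 * (cmod (g x))\<^sup>2)"
      using assms by (simp add: L2_integrable_square)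
    show "AE x in lebesgue_on I. norm ((cmod (f x + g x))\<^sup>2) \<le> norm (2 * (cmod (f x))\<^sup>2 + 2 * (cmod (g x))\<^sup>2)"
    proof (intro AE_I2)
      fix x
      have "(cmod (f x + g x))\<^sup>2 \<le> (cmod (f x) + cmod (g x))\<^sup>2"
        by (intro power_mono norm_triangle_ineq) simp
      also have "\<dots> \<le> 2 * (cmod (f x))\<^sup>2 + 2 * (cmod (g x))\<^sup>2"
        using zero_le_power2[of "cmod (f x) - cmod (g x)"] by (simp add: power2_diff power2_sum)
      finally show "norm ((cmod (f x + g x))\<^sup>2) \<le> norm (2 * (cmod (f x))\<^sup>2 + 2 * (cmod (g x))\<^sup>2)"
        by simp
    qed
  qed measurable
  then show ?thesis by (simp add: L2_def)
qed

lemma L2_diff: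
  assumes "f \<in> L2 I" "g \<in> L2 I"
  shows "(\<lambda>x. f x - g x) \<in> L2 I"
  using L2_add[OF assms(1) L2_cmult[OF assms(2), of "-1"]] by simp

lemma L2_sum:
  "finite A \<Longrightarrow> (\<And>a. a \<in> A \<Longrightarrow> f a \<in> L2 I) \<Longrightarrow> (\<lambda>x. \<Sum>a\<in>A. f a x) \<in> L2 I"
  by (induction rule: finite_induct) (auto simp: L2_zero intro: L2_add)

lemma L2_inner_add_left:
  assumes "f \<in> L2 I" "g \<in> L2 I" "h \<in> L2 I"
  shows "L2_inner I (\<lambda>x. f x + g x) h = L2_inner I f h + L2_inner I g h"
  using assms by (simp add: L2_inner_def L2_integrable_product distrib_right)

lemma L2_inner_cmult_left: "L2_inner I (\<lambda>x. c * f x) h = c * L2_inner I f h"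
  by (simp add: L2_inner_def mult.assoc)

lemma L2_inner_commute: "L2_inner I g f = cnj (L2_inner I f g)"
proof -
  have "(\<integral>x. cnj (f x * cnj (g x)) \<partial>lebesgue_on I) = cnj (\<integral>x. f x * cnj (g x) \<partial>lebesgue_on I)"
    by (rule integral_bounded_linear'[OF bounded_linear_cnj bounded_linear_cnj]) simp
  then show ?thesis by (simp add: L2_inner_def mult.commute)
qed

lemma L2_inner_add_right:
  assumes "f \<in> L2 I" "g \<in> L2 I" "h \<in> L2 I"
  shows "L2_inner I h (\<lambda>x. f x + g x) = L2_inner I h f + L2_inner I h g"
  using L2_inner_add_left[OF assms] by (metis L2_inner_commute complex_cnj_add)

lemma L2_inner_cmult_right: "L2_inner I h (\<lambda>x. c * f x) = cnj c * L2_inner I h f"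
  using L2_inner_cmult_left[of I c f h] by (metis L2_inner_commute complex_cnj_mult)

lemma L2_inner_self: "L2_inner I f f = of_real ((L2_norm I f)\<^sup>2)"
  unfolding L2_norm_square L2_inner_def complex_norm_square[symmetric] by (rule integral_complex_of_real)

lemma L2_inner_cong_AE:
  assumes "AE x in lebesgue_on I. f x = f' x" "AE x in lebesgue_on I. g x = g' x"
    "f \<in> L2 I" "f' \<in> L2 I" "g \<in> L2 I" "g' \<in> L2 I"
  shows "L2_inner I f g = L2_inner I f' g'"
  unfolding L2_inner_def
proof (rule integral_cong_AE)
  show "AE x in lebesgue_on I. f x * cnj (g x) = f' x * cnj (g' x)"
    using assms(1,2) by eventually_elim simp
qed (intro borel_measurable_integrable L2_integrable_product assms)+

lemma L2_norm_cong_AE: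
  assumes "AE x in lebesgue_on I. f x = g x" "f \<in> L2 I" "g \<in> L2 I"
  shows "L2_norm I f = L2_norm I g"
proof -
  have "L2_inner I f f = L2_inner I g g" using assms by (intro L2_inner_cong_AE)
  then have "(L2_norm I f)\<^sup>2 = (L2_norm I g)\<^sup>2" by (simp only: L2_inner_self of_real_eq_iff)
  then show ?thesis using L2_norm_nonneg by (simp add: power2_eq_iff_nonneg)
qed

lemma L2_norm_eq_0:
  assumes "f \<in> L2 I" "L2_norm I f = 0"
  shows "AE x in lebesgue_on I. f x = 0"
proof -
  have "(\<integral>x. (cmod (f x))\<^sup>2 \<partial>lebesgue_on I) = 0"
    using assms(2) L2_norm_square[of I f] by simp
  then have "AE x in lebesgue_on I. (cmod (f x))\<^sup>2 = 0"
    using integral_nonneg_eq_0_iff_AE[OF L2_integrable_square[OF assms(1)]] by simp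
  then show ?thesis by simp
qed

lemma L2_norm_zero: "L2_norm I (\<lambda>x. 0) = 0"
  by (simp add: L2_norm_def)

lemma L2_norm_cmult: "L2_norm I (\<lambda>x. c * f x) = cmod c * L2_norm I f"
  by (simp add: L2_norm_def norm_mult power_mult_distrib real_sqrt_mult)

lemma L2_norm_add_square:
  assumes "f \<in> L2 I" "g \<in> L2 I"
  shows "(L2_norm I (\<lambda>x. f x + g x))\<^sup>2 = (L2_norm I f)\<^sup>2 + 2 * Re (L2_inner I f g) + (L2_norm I g)\<^sup>2"
proof -
  have "complex_of_real ((L2_norm I (\<lambda>x. f x + g x))\<^sup>2)
    = L2_inner I f f + L2_inner I f g + (L2_inner I g f + L2_inner I g g)"
    unfolding L2_inner_self[symmetric] using assms
    by (simp add: L2_inner_add_left L2_inner_add_right L2_add)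
  then have "Re (complex_of_real ((L2_norm I (\<lambda>x. f x + g x))\<^sup>2))
    = Re (L2_inner I f f + L2_inner I f g + (L2_inner I g f + L2_inner I g g))" by simp
  then show ?thesis by (simp add: L2_inner_self L2_inner_commute[of I g f])
qed

lemma L2_pythagoras:
  assumes "f \<in> L2 I" "g \<in> L2 I" "L2_inner I f g = 0"
  shows "(L2_norm I (\<lambda>x. f x + g x))\<^sup>2 = (L2_norm I f)\<^sup>2 + (L2_norm I g)\<^sup>2"
  using L2_norm_add_square[OF assms(1,2)] assms(3) by simp

lemma L2_cauchy_schwarz_Re:
  assumes "f \<in> L2 I" "g \<in> L2 I"
  shows "Re (L2_inner I f g) \<le> L2_norm I f * L2_norm I g"
proof -
  define A B where "A = L2_norm I f" and "B = L2_norm I g"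
  have nn: "A \<ge> 0" "B \<ge> 0" by (simp_all add: A_def B_def L2_norm_nonneg)
  have *: "2 * (s * t) * Re (L2_inner I f g) \<le> s\<^sup>2 * A\<^sup>2 + t\<^sup>2 * B\<^sup>2" for s t :: real
  proof -
    have "0 \<le> (L2_norm I (\<lambda>x. of_real s * f x + of_real (-t) * g x))\<^sup>2" by simp
    also have "\<dots> = s\<^sup>2 * A\<^sup>2 - 2 * (s * t) * Re (L2_inner I f g) + t\<^sup>2 * B\<^sup>2"
      by (subst L2_norm_add_square)
        (simp_all add: assms L2_cmult L2_norm_cmult L2_inner_cmult_left L2_inner_cmult_right
          A_def B_def power_mult_distrib del: of_real_minus)
    finally show ?thesis by simp
  qed
  show ?thesis
  proof (cases "A = 0 \<or> B = 0")
    case True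
    have "L2_inner I f g = 0"
    proof -
      have "(AE x in lebesgue_on I. f x = 0) \<or> (AE x in lebesgue_on I. g x = 0)"
        using True assms L2_norm_eq_0 by (auto simp: A_def B_def)
      then have "AE x in lebesgue_on I. f x * cnj (g x) = 0" by auto
      then show ?thesis unfolding L2_inner_def by (rule integral_eq_zero_AE)
    qed
    then show ?thesis using nn by (simp add: A_def B_def)
  next
    case False
    then have "A * B > 0" using nn by (simp add: order_less_le)
    \<comment> \<open>The weights s = B and t = A make both squares equal to (A * B)^2.\<close>
    moreover have "(A * B) * Re (L2_inner I f g) \<le> (A * B) * (A * B)"
      using *[of B A] by (simp add: power2_eq_square algebra_simps)
    ultimately show ?thesis unfolding A_def[symmetric] B_def[symmetric] by (rule mult_left_le_imp_le[rotated])
  qed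
qed

lemma L2_norm_triangle:
  assumes "f \<in> L2 I" "g \<in> L2 I"
  shows "L2_norm I (\<lambda>x. f x + g x) \<le> L2_norm I f + L2_norm I g"
proof (rule power2_le_imp_le)
  show "(L2_norm I (\<lambda>x. f x + g x))\<^sup>2 \<le> (L2_norm I f + L2_norm I g)\<^sup>2"
    using L2_cauchy_schwarz_Re[OF assms] by (simp add: L2_norm_add_square[OF assms] power2_sum)
qed (simp add: L2_norm_nonneg)

section \<open>Finite spans as sets of functions, with pointwise rather than almost-everywhere
  equality\<close>

definition lin_span :: "(real \<Rightarrow> complex) set \<Rightarrow> (real \<Rightarrow> complex) set" where
  "lin_span B = {f. \<exists>c. f = (\<lambda>x. \<Sum>b\<in>B. c b * b x)}"

lemma lin_span_add: "f \<in> lin_span B \<Longrightarrow> g \<in> lin_span B \<Longrightarrow> (\<lambda>x. f x + g x) \<in> lin_span B"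
  unfolding lin_span_def
proof clarify
  fix c d
  show "\<exists>e. (\<lambda>x. (\<Sum>b\<in>B. c b * b x) + (\<Sum>b\<in>B. d b * b x)) = (\<lambda>x. \<Sum>b\<in>B. e b * b x)"
    by (intro exI[of _ "\<lambda>b. c b + d b"]) (simp add: distrib_right sum.distrib)
qed

lemma lin_span_cmult: "f \<in> lin_span B \<Longrightarrow> (\<lambda>x. a * f x) \<in> lin_span B"
  unfolding lin_span_def
proof clarify
  fix c
  show "\<exists>e. (\<lambda>x. a * (\<Sum>b\<in>B. c b * b x)) = (\<lambda>x. \<Sum>b\<in>B. e b * b x)"
    by (intro exI[of _ "\<lambda>b. a * c b"]) (simp add: sum_distrib_left mult.assoc)
qed

lemma lin_span_insert:
  assumes "finite B" "b0 \<notin> B"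
  shows "f \<in> lin_span (insert b0 B) \<longleftrightarrow> (\<exists>s\<in>lin_span B. \<exists>a. f = (\<lambda>x. s x + a * b0 x))"
proof
  assume "f \<in> lin_span (insert b0 B)"
  then obtain c where "f = (\<lambda>x. \<Sum>b\<in>insert b0 B. c b * b x)" unfolding lin_span_def by blast
  then have "f = (\<lambda>x. (\<Sum>b\<in>B. c b * b x) + c b0 * b0 x)"
    using assms by (simp add: add.commute)
  moreover have "(\<lambda>x. \<Sum>b\<in>B. c b * b x) \<in> lin_span B" unfolding lin_span_def by blast
  ultimately show "\<exists>s\<in>lin_span B. \<exists>a. f = (\<lambda>x. s x + a * b0 x)"
    by (intro bexI[of _ "\<lambda>x. \<Sum>b\<in>B. c b * b x"] exI[of _ "c b0"])
next
  assume "\<exists>s\<in>lin_span B. \<exists>a. f = (\<lambda>x. s x + a * b0 x)"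
  then obtain c a where f: "f = (\<lambda>x. (\<Sum>b\<in>B. c b * b x) + a * b0 x)" unfolding lin_span_def by blast
  have "(\<Sum>b\<in>B. (c(b0 := a)) b * b x) = (\<Sum>b\<in>B. c b * b x)" for x
    using assms by (intro sum.cong) auto
  then have "f = (\<lambda>x. \<Sum>b\<in>insert b0 B. (c(b0 := a)) b * b x)"
    using f assms by (simp add: add.commute)
  then show "f \<in> lin_span (insert b0 B)" unfolding lin_span_def by blast
qed

lemma lin_span_insertE:
  assumes "finite B" "b0 \<notin> B" "f \<in> lin_span (insert b0 B)"
  obtains s a where "s \<in> lin_span B" "f = (\<lambda>x. s x + a * b0 x)"
  using lin_span_insert[OF assms(1,2), THEN iffD1, OF assms(3)] by (elim bexE exE)

lemma lin_span_subset:
  assumes "finite B" "B \<subseteq> X" "(\<lambda>x. 0) \<in> X"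
    and "\<And>f g. f \<in> X \<Longrightarrow> g \<in> X \<Longrightarrow> (\<lambda>x. f x + g x) \<in> X"
    and "\<And>c f. f \<in> X \<Longrightarrow> (\<lambda>x. c * f x) \<in> X"
  shows "lin_span B \<subseteq> X"
  using assms(1,2)
proof (induction rule: finite_induct)
  case empty
  then show ?case using assms(3) by (simp add: lin_span_def)
next
  case (insert b B)
  then show ?case using assms(4,5) by (fastforce simp: lin_span_insert)
qed

lemma lin_span_L2: "finite B \<Longrightarrow> B \<subseteq> L2 I \<Longrightarrow> lin_span B \<subseteq> L2 I"
  by (rule lin_span_subset) (auto intro: L2_zero L2_add L2_cmult)

text \<open>Gram-Schmidt, one spanning function at a time: \<open>e\<close> is the part of
  \<open>b0\<close> orthogonal to the earlier span, and the projection of \<open>f\<close> gains a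
  multiple of \<open>e\<close>. The induction hypothesis is used for both \<open>b0\<close> and
  \<open>f\<close>. The functions in \<open>B\<close> may be linearly dependent.\<close>

lemma lin_span_projection:
  assumes "finite B" "B \<subseteq> L2 I" "f \<in> L2 I"
  shows "\<exists>p\<in>lin_span B. \<forall>u\<in>lin_span B. L2_inner I (\<lambda>x. f x - p x) u = 0"
  using assms
proof (induction arbitrary: f rule: finite_induct)
  case empty
  then show ?case by (simp add: lin_span_def L2_inner_def)
next
  case (insert b0 B)
  have BL: "lin_span B \<subseteq> L2 I" using insert lin_span_L2 by simp
  have b0: "b0 \<in> L2 I" using insert by simp
  obtain p0 where p0: "p0 \<in> lin_span B" "\<And>u. u \<in> lin_span B \<Longrightarrow> L2_inner I (\<lambda>x. b0 x - p0 x) u = 0"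
    using insert.IH[OF _ b0] insert.prems by auto
  obtain p1 where p1: "p1 \<in> lin_span B" "\<And>u. u \<in> lin_span B \<Longrightarrow> L2_inner I (\<lambda>x. f x - p1 x) u = 0"
    using insert.IH[of f] insert.prems by auto
  define e where "e x = b0 x - p0 x" for x
  have eL: "e \<in> L2 I" unfolding e_def using b0 p0 BL by (intro L2_diff) auto
  have fL: "(\<lambda>x. f x - p1 x) \<in> L2 I" using insert.prems p1 BL by (intro L2_diff) auto
  \<comment> \<open>If \<open>e\<close> has norm 0, the quotient is 0 by division by zero, and
    \<open>re\<close> still holds because \<open>e\<close> vanishes almost everywhere.\<close>
  define r where "r = L2_inner I (\<lambda>x. f x - p1 x) e / L2_inner I e e"
  have re: "L2_inner I (\<lambda>x. f x - p1 x) e = r * L2_inner I e e"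
  proof (cases "L2_norm I e = 0")
    case True
    then have "AE x in lebesgue_on I. e x = 0" using L2_norm_eq_0 eL by blast
    then have "AE x in lebesgue_on I. (f x - p1 x) * cnj (e x) = 0" by eventually_elim simp
    then have "L2_inner I (\<lambda>x. f x - p1 x) e = 0" unfolding L2_inner_def by (rule integral_eq_zero_AE)
    then show ?thesis by (simp add: r_def)
  qed (simp add: r_def L2_inner_self)
  define p where "p x = p1 x + r * e x" for x
  have "p = (\<lambda>x. (p1 x + (- r) * p0 x) + r * b0 x)"
    by (auto simp: p_def e_def algebra_simps)
  moreover have "(\<lambda>x. p1 x + (- r) * p0 x) \<in> lin_span B"
    by (intro lin_span_add lin_span_cmult p0 p1)
  ultimately have pS: "p \<in> lin_span (insert b0 B)"
    using insert.hyps by (auto simp: lin_span_insert)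
  have split: "L2_inner I (\<lambda>x. f x - p x) u = L2_inner I (\<lambda>x. f x - p1 x) u - r * L2_inner I e u"
    if "u \<in> L2 I" for u
    using L2_inner_add_left[OF fL L2_cmult[OF eL, of "- r"] that]
    by (simp add: L2_inner_cmult_left[of I "-r" e, simplified] p_def diff_diff_eq)
  have "L2_inner I (\<lambda>x. f x - p x) u = 0" if u: "u \<in> lin_span (insert b0 B)" for u
  proof -
    obtain s a where s: "s \<in> lin_span B" and us: "u = (\<lambda>x. s x + a * b0 x)"
      by (rule lin_span_insertE[OF insert.hyps(1,2) u])
    define s' where "s' x = s x + a * p0 x" for x
    have s': "s' \<in> lin_span B" unfolding s'_def by (intro lin_span_add lin_span_cmult s p0)
    then have s'L: "s' \<in> L2 I" using BL by blast
    have u': "u = (\<lambda>x. s' x + a * e x)" by (simp add: us s'_def e_def algebra_simps)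
    have hL: "(\<lambda>x. f x - p x) \<in> L2 I"
      using L2_diff[OF fL L2_cmult[OF eL, of r]] by (simp add: p_def diff_diff_eq)
    have "L2_inner I (\<lambda>x. f x - p x) u = L2_inner I (\<lambda>x. f x - p x) s' + cnj a * L2_inner I (\<lambda>x. f x - p x) e"
      unfolding u' using L2_inner_add_right[OF s'L L2_cmult[OF eL] hL] by (simp add: L2_inner_cmult_right)
    also have "L2_inner I (\<lambda>x. f x - p x) s' = 0"
      using split[OF s'L] p1(2)[OF s'] p0(2)[OF s'] by (simp add: e_def[abs_def])
    also have "L2_inner I (\<lambda>x. f x - p x) e = 0"
      using split[OF eL] re by simp
    finally show ?thesis by simp
  qed
  then show ?case using pS by blast
qed

lemma L2_subspace_add: "L2_subspace I U \<Longrightarrow> f \<in> U \<Longrightarrow> g \<in> U \<Longrightarrow> (\<lambda>x. f x + g x) \<in> U"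
  by (simp add: L2_subspace_def)

lemma L2_subspace_cmult: "L2_subspace I U \<Longrightarrow> f \<in> U \<Longrightarrow> (\<lambda>x. c * f x) \<in> U"
  by (simp add: L2_subspace_def)

text \<open>Existence is what makes the choice in \<open>L2_proj\<close> meaningful. A projection
  onto the pointwise span serves, because every element of \<open>U\<close> agrees almost everywhere
  with an element of that span.\<close>

lemma L2_proj:
  assumes U: "L2_subspace I U" "L2_finite_dim I U" and f: "f \<in> L2 I"
  shows "L2_proj I U f \<in> U" and "\<And>u. u \<in> U \<Longrightarrow> L2_inner I (\<lambda>x. f x - L2_proj I U f x) u = 0"
proof -
  obtain B where B: "finite B" "B \<subseteq> U"
    and span: "\<And>f. f \<in> U \<Longrightarrow> \<exists>c. AE x in lebesgue_on I. f x = (\<Sum>b\<in>B. c b * b x)"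
    using U(2) unfolding L2_finite_dim_def by blast
  have UL: "U \<subseteq> L2 I" using U(1) by (simp add: L2_subspace_def)
  have SU: "lin_span B \<subseteq> U"
    using B U(1) unfolding L2_subspace_def by (intro lin_span_subset) auto
  obtain p where p: "p \<in> lin_span B" "\<And>u. u \<in> lin_span B \<Longrightarrow> L2_inner I (\<lambda>x. f x - p x) u = 0"
    using lin_span_projection[of B I f] B UL f by blast
  have fp: "(\<lambda>x. f x - p x) \<in> L2 I" using f p SU UL by (intro L2_diff) auto
  have "L2_inner I (\<lambda>x. f x - p x) u = 0" if "u \<in> U" for u
  proof -
    obtain c where c: "AE x in lebesgue_on I. u x = (\<Sum>b\<in>B. c b * b x)" using span \<open>u \<in> U\<close> by blast
    have s: "(\<lambda>x. \<Sum>b\<in>B. c b * b x) \<in> lin_span B" unfolding lin_span_def by blast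
    have "L2_inner I (\<lambda>x. f x - p x) u = L2_inner I (\<lambda>x. f x - p x) (\<lambda>x. \<Sum>b\<in>B. c b * b x)"
      using c s SU UL that fp by (intro L2_inner_cong_AE) auto
    then show ?thesis using p(2)[OF s] by simp
  qed
  then have "\<exists>g. g \<in> U \<and> (\<forall>u\<in>U. L2_inner I (\<lambda>x. f x - g x) u = 0)" using p SU by blast
  from someI_ex[OF this] show "L2_proj I U f \<in> U"
    "\<And>u. u \<in> U \<Longrightarrow> L2_inner I (\<lambda>x. f x - L2_proj I U f x) u = 0"
    unfolding L2_proj_def by auto
qed

lemma L2_proj_norm_le:
  assumes U: "L2_subspace I U" "L2_finite_dim I U" and f: "f \<in> L2 I"
  shows "L2_norm I (L2_proj I U f) \<le> L2_norm I f"
proof (rule power2_le_imp_le)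
  note P = L2_proj[OF U f]
  have PL: "L2_proj I U f \<in> L2 I" using P(1) U(1) by (auto simp: L2_subspace_def)
  have "(L2_norm I (\<lambda>x. (f x - L2_proj I U f x) + L2_proj I U f x))\<^sup>2
     = (L2_norm I (\<lambda>x. f x - L2_proj I U f x))\<^sup>2 + (L2_norm I (L2_proj I U f))\<^sup>2"
    using P by (intro L2_pythagoras L2_diff f PL) auto
  then show "(L2_norm I (L2_proj I U f))\<^sup>2 \<le> (L2_norm I f)\<^sup>2" by simp
qed (rule L2_norm_nonneg)

lemma L2_proj_best_approximation:
  assumes U: "L2_subspace I U" "L2_finite_dim I U" and f: "f \<in> L2 I" and s: "s \<in> U"
  shows "L2_norm I (\<lambda>x. f x - L2_proj I U f x) \<le> L2_norm I (\<lambda>x. f x - s x)"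
proof (rule power2_le_imp_le)
  note P = L2_proj[OF U f]
  have PL: "L2_proj I U f \<in> L2 I" using P(1) U(1) by (auto simp: L2_subspace_def)
  have "(\<lambda>x. L2_proj I U f x + (- 1) * s x) \<in> U"
    by (intro L2_subspace_add[OF U(1)] L2_subspace_cmult[OF U(1)] P(1) s)
  then have d: "(\<lambda>x. L2_proj I U f x - s x) \<in> U" by simp
  then have dL: "(\<lambda>x. L2_proj I U f x - s x) \<in> L2 I" using U(1) by (auto simp: L2_subspace_def)
  have "(L2_norm I (\<lambda>x. (f x - L2_proj I U f x) + (L2_proj I U f x - s x)))\<^sup>2
     = (L2_norm I (\<lambda>x. f x - L2_proj I U f x))\<^sup>2 + (L2_norm I (\<lambda>x. L2_proj I U f x - s x))\<^sup>2"
    using P d by (intro L2_pythagoras L2_diff f PL dL) auto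
  then show "(L2_norm I (\<lambda>x. f x - L2_proj I U f x))\<^sup>2 \<le> (L2_norm I (\<lambda>x. f x - s x))\<^sup>2" by simp
qed (rule L2_norm_nonneg)

text \<open>Instead of compactness of the unit sphere, orthogonal splitting: for f = s' + a e with
  s' orthogonal to e, both |s'| and |a e| are at most |f| in norm, so the bounds add up. Dependent
  functions are allowed because independence on the whole interval does not survive restriction to
  one piece.\<close>

lemma lin_span_seminorm_bound:
  fixes q :: "(real \<Rightarrow> complex) \<Rightarrow> real"
  assumes "finite B" "B \<subseteq> X" and X: "X \<subseteq> L2 I" "(\<lambda>x. 0) \<in> X"
    and Xadd: "\<And>f g. f \<in> X \<Longrightarrow> g \<in> X \<Longrightarrow> (\<lambda>x. f x + g x) \<in> X"
    and Xcmult: "\<And>c f. f \<in> X \<Longrightarrow> (\<lambda>x. c * f x) \<in> X"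
    and qadd: "\<And>f g. f \<in> X \<Longrightarrow> g \<in> X \<Longrightarrow> q (\<lambda>x. f x + g x) \<le> q f + q g"
    and qcmult: "\<And>c f. f \<in> X \<Longrightarrow> q (\<lambda>x. c * f x) \<le> cmod c * q f"
    and qnull: "\<And>f. f \<in> X \<Longrightarrow> L2_norm I f = 0 \<Longrightarrow> q f = 0"
    and qnonneg: "\<And>f. f \<in> X \<Longrightarrow> q f \<ge> 0"
  shows "\<exists>K\<ge>0. \<forall>f\<in>lin_span B. q f \<le> K * L2_norm I f"
  using assms(1,2)
proof (induction rule: finite_induct)
  case empty
  then show ?case using qnull[OF X(2)] by (auto simp: lin_span_def L2_norm_zero)
next
  case (insert b0 B)
  then obtain K where K: "K \<ge> 0" "\<And>f. f \<in> lin_span B \<Longrightarrow> q f \<le> K * L2_norm I f" by auto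
  have SX: "lin_span B \<subseteq> X" using insert X Xadd Xcmult by (intro lin_span_subset) auto
  have b0: "b0 \<in> X" using insert by simp
  obtain p0 where p0: "p0 \<in> lin_span B" "\<And>u. u \<in> lin_span B \<Longrightarrow> L2_inner I (\<lambda>x. b0 x - p0 x) u = 0"
    using lin_span_projection[of B I b0] insert.hyps insert.prems X by blast
  define e where "e x = b0 x - p0 x" for x
  have "(\<lambda>x. b0 x + (-1) * p0 x) \<in> X" using p0 SX b0 by (intro Xadd Xcmult) auto
  then have eX: "e \<in> X" by (simp add: e_def[abs_def])
  then have eL: "e \<in> L2 I" using X by blast
  \<comment> \<open>When \<open>e\<close> has norm 0 the quotient is 0 by division by zero, and
    \<open>qnull\<close> makes \<open>q e\<close> equal to 0 too.\<close>
  define K' where "K' = K + q e / L2_norm I e"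
  have "q f \<le> K' * L2_norm I f" if f: "f \<in> lin_span (insert b0 B)" for f
  proof -
    obtain s a where s: "s \<in> lin_span B" and fs: "f = (\<lambda>x. s x + a * b0 x)"
      by (rule lin_span_insertE[OF insert.hyps(1,2) f])
    define s' where "s' x = s x + a * p0 x" for x
    have s': "s' \<in> lin_span B" unfolding s'_def by (intro lin_span_add lin_span_cmult s p0)
    then have s'X: "s' \<in> X" and s'L: "s' \<in> L2 I" using SX X by auto
    have f': "f = (\<lambda>x. s' x + a * e x)" by (simp add: fs s'_def e_def algebra_simps)
    have "L2_inner I e s' = 0" using p0(2)[OF s'] by (simp add: e_def[abs_def])
    then have "L2_inner I s' (\<lambda>x. a * e x) = 0"
      by (simp add: L2_inner_cmult_right L2_inner_commute[of I s' e])
    then have n: "(L2_norm I f)\<^sup>2 = (L2_norm I s')\<^sup>2 + (cmod a * L2_norm I e)\<^sup>2"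
      unfolding f' using L2_pythagoras[OF s'L L2_cmult[OF eL]] by (simp add: L2_norm_cmult)
    have n1: "L2_norm I s' \<le> L2_norm I f" 
      by (rule power2_le_imp_le) (simp_all add: n L2_norm_nonneg)
    have n2: "cmod a * L2_norm I e \<le> L2_norm I f"
      by (rule power2_le_imp_le) (simp_all add: n L2_norm_nonneg)
    have "q f \<le> q s' + q (\<lambda>x. a * e x)" unfolding f' by (intro qadd s'X Xcmult eX)
    also have "\<dots> \<le> K * L2_norm I s' + cmod a * q e" by (intro add_mono K s' qcmult eX)
    also have "cmod a * q e = q e / L2_norm I e * (cmod a * L2_norm I e)"
      using qnull[OF eX] by auto
    also have "K * L2_norm I s' + q e / L2_norm I e * (cmod a * L2_norm I e)
       \<le> K * L2_norm I f + q e / L2_norm I e * L2_norm I f"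
      by (intro add_mono mult_left_mono n1 n2 K divide_nonneg_nonneg qnonneg eX L2_norm_nonneg)
    finally show ?thesis by (simp add: K'_def distrib_right)
  qed
  moreover have "K' \<ge> 0" unfolding K'_def by (intro add_nonneg_nonneg K divide_nonneg_nonneg qnonneg eX L2_norm_nonneg)
  ultimately show ?case by blast
qed

section \<open>The Sobolev space on an interval\<close>

lemma norm_le_one_plus_square: "norm z \<le> 1 + (norm z)\<^sup>2"
  for z :: "'a::real_normed_vector"
proof -
  have "2 * norm z \<le> 1 + (norm z)\<^sup>2"
    using sum_squares_bound[of 1 "norm z"] by simp
  then show ?thesis using norm_ge_zero[of z] by linarith
qed

lemma L2_imp_integrable:
  fixes f :: "real \<Rightarrow> complex"
  assumes "f \<in> L2 {a<..<b}"
  shows "integrable (lebesgue_on {a<..<b}) f"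
proof (rule Bochner_Integration.integrable_bound)
  interpret finite_measure "lebesgue_on {a<..<b}" by (simp add: finite_measure_lebesgue_on)
  show "integrable (lebesgue_on {a<..<b}) (\<lambda>x. 1 + (cmod (f x))\<^sup>2)"
    using L2_integrable_square[OF assms] by simp
  show "AE x in lebesgue_on {a<..<b}. norm (f x) \<le> norm (1 + (cmod (f x))\<^sup>2)"
  proof (intro AE_I2)
    fix x
    show "norm (f x) \<le> norm (1 + (cmod (f x))\<^sup>2)"
      by (simp add: norm_le_one_plus_square)
  qed
qed (rule L2_measurable[OF assms])

lemma L2_subset:
  assumes "f \<in> L2 T" "S \<subseteq> T" "S \<in> sets lebesgue" "T \<in> sets lebesgue"
  shows "f \<in> L2 S"
  using assms measurable_restrict_mono[OF L2_measurable[OF assms(1)] assms(2)]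
    integrable_lebesgue_on_subset[OF L2_integrable_square[OF assms(1)]]
  by (simp add: L2_def)

text \<open>Measurability of \<open>g\<close> comes from completeness of Lebesgue measure. The lemma
  is needed for \<open>weak_deriv\<close>, about whose chosen representative nothing else is
  known.\<close>

lemma L2_AE_cong:
  assumes "f \<in> L2 {a<..<b}" "AE x in lebesgue_on {a<..<b}. f x = g x"
  shows "g \<in> L2 {a<..<b}"
proof -
  let ?I = "{a<..<b}"
  have "(\<lambda>x. if x \<in> ?I then f x else 0) \<in> borel_measurable lebesgue"
    using L2_measurable[OF assms(1)] by (intro borel_measurable_if_I) auto
  then have "(\<lambda>x. if x \<in> ?I then g x else 0) \<in> borel_measurable lebesgue"
    by (rule borel_measurable_AE) (use assms(2) in \<open>auto simp: AE_restrict_space_iff elim: eventually_mono\<close>)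
  then have g: "g \<in> borel_measurable (lebesgue_on ?I)"
    by (rule borel_measurable_if_D)
  have "integrable (lebesgue_on ?I) (\<lambda>x. (cmod (g x))\<^sup>2)"
  proof (rule integrable_cong_AE_imp[OF L2_integrable_square[OF assms(1)]])
    show "(\<lambda>x. (cmod (g x))\<^sup>2) \<in> borel_measurable (lebesgue_on ?I)" using g by measurable
    show "AE x in lebesgue_on ?I. (cmod (f x))\<^sup>2 = (cmod (g x))\<^sup>2"
      using assms(2) by eventually_elim simp
  qed
  with g show ?thesis by (simp add: L2_def)
qed

lemma has_weak_derivative_weak_deriv:
  "has_weak_derivative I f g \<Longrightarrow> has_weak_derivative I f (weak_deriv I f)"
  unfolding weak_deriv_def by (rule someI[of "has_weak_derivative I f"])

lemma weak_deriv_AE_eq: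
  "has_weak_derivative {a<..<b} f g \<Longrightarrow> AE x in lebesgue_on {a<..<b}. g x = weak_deriv {a<..<b} f x"
  by (rule weak_derivative_unique[OF _ has_weak_derivative_weak_deriv])

text \<open>\<open>H1\<close> provides some square-integrable weak derivative, while
  \<open>weak_deriv\<close> may pick another one; uniqueness transfers square integrability to the
  choice.\<close>

lemma H1_weak_deriv:
  assumes "f \<in> H1 {a<..<b}"
  shows "weak_deriv {a<..<b} f \<in> L2 {a<..<b}"
    and "has_weak_derivative {a<..<b} f (weak_deriv {a<..<b} f)"
proof -
  obtain g where g: "g \<in> L2 {a<..<b}" "has_weak_derivative {a<..<b} f g"
    using assms unfolding H1_def by blast
  show "weak_deriv {a<..<b} f \<in> L2 {a<..<b}"
    by (rule L2_AE_cong[OF g(1) weak_deriv_AE_eq[OF g(2)]])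
  show "has_weak_derivative {a<..<b} f (weak_deriv {a<..<b} f)"
    by (rule has_weak_derivative_weak_deriv[OF g(2)])
qed

lemma H1_L2: "f \<in> H1 I \<Longrightarrow> f \<in> L2 I"
  by (simp add: H1_def)

section \<open>The weak derivative as a linear operation and its seminorm\<close>

lemma integrable_test_product:
  assumes f: "integrable (lebesgue_on {a<..<b}) f" and t: "test_function {a<..<b} \<phi>"
  shows "integrable (lebesgue_on {a<..<b}) (\<lambda>x. f x * \<phi> x)"
    and "integrable (lebesgue_on {a<..<b}) (\<lambda>x. f x * vector_derivative \<phi> (at x))"
proof -
  obtain \<phi>' where \<phi>': "\<And>x. (\<phi> has_vector_derivative \<phi>' x) (at x)" "continuous_on UNIV \<phi>'"
    and eq: "\<And>x. vector_derivative \<phi> (at x) = \<phi>' x"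
    using test_functionD[OF t] by metis
  have cont': "continuous_on {a..b} \<phi>'" using \<phi>'(2) continuous_on_subset by blast
  have cont: "continuous_on {a..b} \<phi>"
    using \<phi>'(1) by (meson continuous_at_imp_continuous_on has_vector_derivative_continuous)
  have f': "integrable (lebesgue_on {a..b}) f" using f by (simp add: integrable_lebesgue_on_Icc_iff_Ioo)
  show "integrable (lebesgue_on {a<..<b}) (\<lambda>x. f x * \<phi> x)"
    using integrable_mult_continuous[OF f' cont] by (simp add: integrable_lebesgue_on_Icc_iff_Ioo)
  show "integrable (lebesgue_on {a<..<b}) (\<lambda>x. f x * vector_derivative \<phi> (at x))"
    using integrable_mult_continuous[OF f' cont'] by (simp add: integrable_lebesgue_on_Icc_iff_Ioo eq)
qed

lemma has_weak_derivative_add: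
  assumes i: "integrable (lebesgue_on {a<..<b}) f1" "integrable (lebesgue_on {a<..<b}) f2"
    "integrable (lebesgue_on {a<..<b}) g1" "integrable (lebesgue_on {a<..<b}) g2"
    and w: "has_weak_derivative {a<..<b} f1 g1" "has_weak_derivative {a<..<b} f2 g2"
  shows "has_weak_derivative {a<..<b} (\<lambda>x. f1 x + f2 x) (\<lambda>x. g1 x + g2 x)"
  unfolding has_weak_derivative_def
proof (intro conjI allI impI)
  show "locally_integrable_on (\<lambda>x. f1 x + f2 x) {a<..<b}" "locally_integrable_on (\<lambda>x. g1 x + g2 x) {a<..<b}"
    using w unfolding has_weak_derivative_def locally_integrable_on_def by auto
  fix \<phi> assume t: "test_function {a<..<b} \<phi>"
  show "(\<integral>x. (f1 x + f2 x) * vector_derivative \<phi> (at x) \<partial>lebesgue_on {a<..<b})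
     = - (\<integral>x. (g1 x + g2 x) * \<phi> x \<partial>lebesgue_on {a<..<b})"
    using w t i[THEN integrable_test_product(1)[OF _ t]] i[THEN integrable_test_product(2)[OF _ t]]
    by (simp add: has_weak_derivative_def distrib_right)
qed

lemma has_weak_derivative_cmult:
  assumes w: "has_weak_derivative I f g"
  shows "has_weak_derivative I (\<lambda>x. c * f x) (\<lambda>x. c * g x)"
  using w by (simp add: has_weak_derivative_def locally_integrable_on_def mult.assoc)

lemma H1_add_weak_derivative:
  assumes "f \<in> H1 {a<..<b}" "g \<in> H1 {a<..<b}"
  shows "has_weak_derivative {a<..<b} (\<lambda>x. f x + g x) (\<lambda>x. weak_deriv {a<..<b} f x + weak_deriv {a<..<b} g x)"
  using assms by (intro has_weak_derivative_add L2_imp_integrable H1_L2 H1_weak_deriv)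

lemma H1_add: "f \<in> H1 {a<..<b} \<Longrightarrow> g \<in> H1 {a<..<b} \<Longrightarrow> (\<lambda>x. f x + g x) \<in> H1 {a<..<b}"
  using H1_add_weak_derivative[of f a b g] L2_add H1_L2 H1_weak_deriv(1)
  by (subst H1_def) blast

lemma H1_cmult: "f \<in> H1 {a<..<b} \<Longrightarrow> (\<lambda>x. c * f x) \<in> H1 {a<..<b}"
  using has_weak_derivative_cmult[OF H1_weak_deriv(2)] L2_cmult H1_L2 H1_weak_deriv(1)
  by (subst H1_def) blast

lemma H1_zero: "(\<lambda>x. 0) \<in> H1 I"
  by (auto simp: H1_def has_weak_derivative_def locally_integrable_on_def L2_zero intro!: bexI[of _ "\<lambda>x. 0"])

abbreviation D_norm :: "real set \<Rightarrow> (real \<Rightarrow> complex) \<Rightarrow> real" where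
  "D_norm I f \<equiv> L2_norm I (weak_deriv I f)"

lemma D_norm_add:
  assumes "f \<in> H1 {a<..<b}" "g \<in> H1 {a<..<b}"
  shows "D_norm {a<..<b} (\<lambda>x. f x + g x) \<le> D_norm {a<..<b} f + D_norm {a<..<b} g"
proof -
  let ?I = "{a<..<b}"
  note d = H1_weak_deriv(1)[OF assms(1)] H1_weak_deriv(1)[OF assms(2)]
  have "D_norm ?I (\<lambda>x. f x + g x) = L2_norm ?I (\<lambda>x. weak_deriv ?I f x + weak_deriv ?I g x)"
    by (rule L2_norm_cong_AE[OF weak_deriv_AE_eq[OF H1_add_weak_derivative[OF assms]], symmetric])
      (intro L2_add d H1_weak_deriv(1) H1_add assms)+
  also have "\<dots> \<le> D_norm ?I f + D_norm ?I g" by (rule L2_norm_triangle[OF d])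
  finally show ?thesis .
qed

lemma D_norm_cmult:
  assumes "f \<in> H1 {a<..<b}"
  shows "D_norm {a<..<b} (\<lambda>x. c * f x) = cmod c * D_norm {a<..<b} f"
proof -
  let ?I = "{a<..<b}"
  note d = H1_weak_deriv[OF assms]
  have "D_norm ?I (\<lambda>x. c * f x) = L2_norm ?I (\<lambda>x. c * weak_deriv ?I f x)"
    by (rule L2_norm_cong_AE[OF weak_deriv_AE_eq[OF has_weak_derivative_cmult[OF d(2)]], symmetric])
      (intro L2_cmult d H1_weak_deriv(1) H1_cmult assms)+
  then show ?thesis by (simp add: L2_norm_cmult)
qed

lemma D_norm_null:
  assumes "f \<in> H1 {a<..<b}" "L2_norm {a<..<b} f = 0"
  shows "D_norm {a<..<b} f = 0"
proof -
  let ?I = "{a<..<b}"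
  have ae: "AE x in lebesgue_on ?I. f x = 0" using assms L2_norm_eq_0 H1_L2 by blast
  have "has_weak_derivative ?I f (\<lambda>x. 0)"
    unfolding has_weak_derivative_def
  proof (intro conjI allI impI)
    show "locally_integrable_on f ?I"
      using H1_weak_deriv(2)[OF assms(1)] by (simp add: has_weak_derivative_def)
    show "locally_integrable_on (\<lambda>x. 0) ?I" by (simp add: locally_integrable_on_def)
    fix \<phi>
    have "AE x in lebesgue_on ?I. f x * vector_derivative \<phi> (at x) = 0"
      using ae by eventually_elim simp
    then show "(\<integral>x. f x * vector_derivative \<phi> (at x) \<partial>lebesgue_on ?I) = - (\<integral>x. 0 * \<phi> x \<partial>lebesgue_on ?I)"
      by (simp add: integral_eq_zero_AE)
  qed
  from L2_norm_cong_AE[OF weak_deriv_AE_eq[OF this] L2_zero H1_weak_deriv(1)[OF assms(1)]]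
  show ?thesis by (simp add: L2_norm_zero)
qed

text \<open>This is the finiteness of \<gamma>. Both norms live on one piece, whereas finite
  dimension is assumed on the larger set \<open>J\<close>, up to null sets.\<close>

lemma finite_dim_D_norm_bound:
  assumes T: "L2_subspace J T" "L2_finite_dim J T" and TH: "T \<subseteq> H1 {a<..<b}"
    and J: "{a<..<b} \<subseteq> J" "J \<in> sets lebesgue"
  shows "\<exists>K\<ge>0. \<forall>f\<in>T. D_norm {a<..<b} f \<le> K * L2_norm {a<..<b} f"
proof -
  let ?I = "{a<..<b}"
  obtain B where B: "finite B" "B \<subseteq> T"
    and span: "\<And>f. f \<in> T \<Longrightarrow> \<exists>c. AE x in lebesgue_on J. f x = (\<Sum>b\<in>B. c b * b x)"
    using T(2) unfolding L2_finite_dim_def by blast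
  have "\<exists>K\<ge>0. \<forall>f\<in>lin_span B. D_norm ?I f \<le> K * L2_norm ?I f"
    by (rule lin_span_seminorm_bound[where X = "H1 ?I"])
      (use B TH in \<open>auto intro: H1_L2 H1_zero H1_add H1_cmult D_norm_add D_norm_null L2_norm_nonneg
         simp: D_norm_cmult\<close>)
  then obtain K where K: "K \<ge> 0" "\<And>f. f \<in> lin_span B \<Longrightarrow> D_norm ?I f \<le> K * L2_norm ?I f" by blast
  have SH: "lin_span B \<subseteq> H1 ?I"
    using B TH by (intro lin_span_subset) (auto intro: H1_zero H1_add H1_cmult)
  have "D_norm ?I f \<le> K * L2_norm ?I f" if f: "f \<in> T" for f
  proof -
    obtain c where c: "AE x in lebesgue_on J. f x = (\<Sum>b\<in>B. c b * b x)" using span[OF f] by blast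
    define s where "s x = (\<Sum>b\<in>B. c b * b x)" for x
    have s: "s \<in> lin_span B" unfolding lin_span_def s_def[abs_def] by blast
    then have sH: "s \<in> H1 ?I" using SH by blast
    have fH: "f \<in> H1 ?I" using f TH by blast
    have ae: "AE x in lebesgue_on ?I. f x = s x"
      using AE_lebesgue_on_subset[OF c J(1) _ J(2)] by (simp add: s_def)
    have n: "L2_norm ?I f = L2_norm ?I s" by (rule L2_norm_cong_AE[OF ae H1_L2[OF fH] H1_L2[OF sH]])
    \<comment> \<open>\<open>f\<close> need not lie in the pointwise span; it differs from
      \<open>s\<close> by a null function, which has derivative seminorm 0.\<close>
    define d where "d x = f x + (-1) * s x" for x
    have dH: "d \<in> H1 ?I" unfolding d_def by (intro H1_add H1_cmult fH sH)
    have "AE x in lebesgue_on ?I. d x = 0" using ae by eventually_elim (simp add: d_def)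
    then have "L2_norm ?I d = L2_norm ?I (\<lambda>x. 0)" by (intro L2_norm_cong_AE H1_L2 dH L2_zero)
    then have d0: "D_norm ?I d = 0" by (intro D_norm_null dH) (simp add: L2_norm_zero)
    have "f = (\<lambda>x. s x + d x)" by (simp add: d_def)
    then have "D_norm ?I f \<le> D_norm ?I s + D_norm ?I d" using D_norm_add[OF sH dH] by simp
    then show ?thesis using K(2)[OF s] d0 n by simp
  qed
  with K(1) show ?thesis by blast
qed

section \<open>Consequences of the representation by an indefinite integral\<close>

lemma H1_indefinite_integral:
  assumes ab: "a < b" and f: "f \<in> H1 {a<..<b}"
  obtains C where "AE x in lebesgue_on {a<..<b}. f x = C + integral {a..x} (weak_deriv {a<..<b} f)"
  using weak_derivative_imp_indefinite_integral[OF ab L2_imp_integrable[OF H1_L2[OF f]]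
      L2_imp_integrable[OF H1_weak_deriv(1)[OF f]] H1_weak_deriv(2)[OF f]] by blast

text \<open>The crude |z| \<le> 1 + |z|^2 replaces Cauchy-Schwarz; the bound only serves to prove
  \<zeta> finite.\<close>

lemma L2_integral_norm_le:
  assumes ab: "a < b" and f: "f \<in> L2 {a<..<b}"
  shows "(\<integral>x. cmod (f x) \<partial>lebesgue_on {a<..<b}) \<le> (b - a) + (L2_norm {a<..<b} f)\<^sup>2"
proof -
  let ?M = "lebesgue_on {a<..<b}"
  interpret finite_measure ?M by (simp add: finite_measure_lebesgue_on)
  have "(\<integral>x. cmod (f x) \<partial>?M) \<le> (\<integral>x. 1 + (cmod (f x))\<^sup>2 \<partial>?M)"
  proof (rule integral_mono)
    show "cmod (f x) \<le> 1 + (cmod (f x))\<^sup>2" for x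
      by (simp add: norm_le_one_plus_square)
  qed (use L2_imp_integrable[OF f] L2_integrable_square[OF f] in auto)
  also have "\<dots> = (b - a) + (L2_norm {a<..<b} f)\<^sup>2"
    using L2_integrable_square[OF f] ab
    by (simp add: L2_norm_square measure_restrict_space)
  finally show ?thesis .
qed

text \<open>Write f as C plus the primitive of its derivative. The primitive is bounded by the L1
  norm of the derivative, and |C| is then controlled by averaging |C| \<le> |f| + R over the
  interval.\<close>

lemma H1_bounded:
  assumes ab: "a < b" and f: "f \<in> H1 {a<..<b}"
    and n: "L2_norm {a<..<b} f \<le> 1" and d: "D_norm {a<..<b} f \<le> \<Gamma>"
  shows "AE x in lebesgue_on {a<..<b}. cmod (f x) \<le> (b - a + 1) / (b - a) + 2 * ((b - a) + \<Gamma>\<^sup>2)"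
proof -
  let ?I = "{a<..<b}" let ?M = "lebesgue_on {a<..<b}" let ?g = "weak_deriv {a<..<b} f"
  interpret finite_measure ?M by (simp add: finite_measure_lebesgue_on)
  have meas: "measure ?M ?I = b - a" using ab by (simp add: measure_restrict_space)
  have fL: "f \<in> L2 ?I" using f H1_L2 by blast
  have gL: "?g \<in> L2 ?I" using f by (rule H1_weak_deriv)
  define R where "R = (b - a) + \<Gamma>\<^sup>2"
  obtain C where C: "AE x in ?M. f x = C + integral {a..x} ?g" using H1_indefinite_integral[OF ab f] .
  have gi: "integrable (lebesgue_on {a..b}) ?g"
    using L2_imp_integrable[OF gL] by (simp add: integrable_lebesgue_on_Icc_iff_Ioo)
  have G: "cmod (integral {a..x} ?g) \<le> R" if x: "x \<in> ?I" for x
  proof -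
    have i: "integrable (lebesgue_on {a..x}) ?g"
      using x by (intro integrable_lebesgue_on_subset[OF gi]) auto
    have "cmod (integral {a..x} ?g) \<le> integral {a..x} (\<lambda>y. cmod (?g y))"
      using i by (intro Henstock_Kurzweil_Integration.integral_norm_bound_integral)
         (simp_all add: integrable_on_lebesgue_on)
    also have "\<dots> \<le> integral {a..b} (\<lambda>y. cmod (?g y))"
      using i gi x by (intro integral_subset_le) (auto simp: integrable_on_lebesgue_on)
    also have "\<dots> = (\<integral>y. cmod (?g y) \<partial>?M)"
      using L2_imp_integrable[OF gL] by (simp add: lebesgue_integral_eq_integral integral_open_interval_real)
    also have "\<dots> \<le> (b - a) + (D_norm ?I f)\<^sup>2" by (rule L2_integral_norm_le[OF ab gL])
    also have "\<dots> \<le> R" unfolding R_def using d by (intro add_left_mono power_mono L2_norm_nonneg)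
    finally show ?thesis .
  qed
  have "(b - a) * cmod C = (\<integral>x. cmod C \<partial>?M)" using meas by simp
  also have "\<dots> \<le> (\<integral>x. cmod (f x) + R \<partial>?M)"
  proof (rule integral_mono_AE)
    show "AE x in ?M. cmod C \<le> cmod (f x) + R"
      using C AE_space
    proof eventually_elim
      case (elim x)
      have "cmod C \<le> cmod (f x) + cmod (integral {a..x} ?g)"
        using norm_triangle_ineq4[of "f x" "integral {a..x} ?g"] elim(1) by simp
      then show ?case using G[of x] elim by simp
    qed
  qed (use L2_imp_integrable[OF fL] in auto)
  also have "\<dots> = (\<integral>x. cmod (f x) \<partial>?M) + (b - a) * R"
    using L2_imp_integrable[OF fL] meas by simp
  also have "(\<integral>x. cmod (f x) \<partial>?M) \<le> (b - a) + 1"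
    using L2_integral_norm_le[OF ab fL] n L2_norm_nonneg[of ?I f] power_le_one[of "L2_norm ?I f" 2] by linarith
  finally have "(b - a) * cmod C \<le> (b - a + 1) + (b - a) * R" by simp
  moreover have "(b - a) * ((b - a + 1) / (b - a)) = b - a + 1" using ab by simp
  ultimately have "(b - a) * cmod C \<le> (b - a) * ((b - a + 1) / (b - a) + R)"
    by (simp only: distrib_left)
  then have CR: "cmod C \<le> (b - a + 1) / (b - a) + R" using ab by simp
  show ?thesis
    using C AE_space
  proof eventually_elim
    case (elim x)
    have "cmod (f x) \<le> cmod C + cmod (integral {a..x} ?g)"
      unfolding elim(1) by (rule norm_triangle_ineq)
    then show ?case using G[of x] elim CR by (simp add: R_def)
  qed
qed

text \<open>Restarting the primitive at \<open>p\<close> changes it only by a constant, which c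
  absorbs together with C and m. The right side keeps the weak derivative on the large interval,
  because \<gamma> refers to whole pieces and not to cells.\<close>

lemma H1_wirtinger_subinterval:
  assumes f: "f \<in> H1 {a<..<b}" and pq: "a \<le> p" "p < q" "q \<le> b"
  obtains c where "(\<integral>x. (cmod (f x - c))\<^sup>2 \<partial>lebesgue_on {p<..<q})
     \<le> ((q - p) / pi)\<^sup>2 * (\<integral>x. (cmod (weak_deriv {a<..<b} f x))\<^sup>2 \<partial>lebesgue_on {p<..<q})"
proof -
  let ?g = "weak_deriv {a<..<b} f" let ?M = "lebesgue_on {p<..<q}"
  have ab: "a < b" using pq by linarith
  have gL: "?g \<in> L2 {a<..<b}" using f by (rule H1_weak_deriv)
  obtain C where C: "AE x in lebesgue_on {a<..<b}. f x = C + integral {a..x} ?g"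
    using H1_indefinite_integral[OF ab f] .
  have sub: "{p<..<q} \<subseteq> {a<..<b}" using pq by auto
  have C': "AE x in ?M. f x = C + integral {a..x} ?g"
    by (rule AE_lebesgue_on_subset[OF C sub]) auto
  have gi: "integrable (lebesgue_on {a..b}) ?g"
    using L2_imp_integrable[OF gL] by (simp add: integrable_lebesgue_on_Icc_iff_Ioo)
  have gpq: "?g \<in> L2 {p<..<q}" by (rule L2_subset[OF gL sub]) auto
  have gi': "integrable (lebesgue_on {p..q}) ?g"
    using pq by (intro integrable_lebesgue_on_subset[OF gi]) auto
  have g2: "integrable (lebesgue_on {p..q}) (\<lambda>x. (cmod (?g x))\<^sup>2)"
    using L2_integrable_square[OF gpq] by (simp add: integrable_lebesgue_on_Icc_iff_Ioo)
  obtain m where m: "integral {p..q} (\<lambda>x. (cmod (integral {p..x} ?g - m))\<^sup>2)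
      \<le> ((q - p) / pi)\<^sup>2 * integral {p..q} (\<lambda>x. (cmod (?g x))\<^sup>2)"
    using wirtinger_neumann[OF pq(2) gi' g2] .
  define c where "c = C + integral {a..p} ?g + m"
  have ae: "AE x in ?M. (cmod (f x - c))\<^sup>2 = (cmod (integral {p..x} ?g - m))\<^sup>2"
    using C' AE_space
  proof eventually_elim
    case (elim x)
    have x: "p < x" "x < q" using elim(2) by simp_all
    have split: "integral {a..p} ?g + integral {p..x} ?g = integral {a..x} ?g"
      using x pq by (intro Henstock_Kurzweil_Integration.integral_combine integrable_on_lebesgue_on integrable_lebesgue_on_subset[OF gi]) auto
    have "f x - c = integral {p..x} ?g - m"
      unfolding elim(1) split[symmetric] c_def by simp
    then show ?case by simp
  qed
  have cont: "continuous_on {p..q} (\<lambda>x. (cmod (integral {p..x} ?g - m))\<^sup>2)"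
    using gi' by (intro continuous_intros indefinite_integral_continuous_1) (simp add: integrable_on_lebesgue_on)
  have ci: "integrable ?M (\<lambda>x. (cmod (integral {p..x} ?g - m))\<^sup>2)"
    by (subst integrable_lebesgue_on_Icc_iff_Ioo[symmetric])
      (auto intro!: absolutely_integrable_imp_integrable absolutely_integrable_continuous_real cont)
  have fL: "f \<in> L2 {p<..<q}" by (rule L2_subset[OF H1_L2[OF f] sub]) auto
  have [measurable]: "f \<in> borel_measurable ?M" using fL by (rule L2_measurable)
  have "(\<integral>x. (cmod (f x - c))\<^sup>2 \<partial>?M) = (\<integral>x. (cmod (integral {p..x} ?g - m))\<^sup>2 \<partial>?M)"
    by (rule integral_cong_AE[OF _ _ ae]) (use ci in measurable)
  also have "\<dots> = integral {p..q} (\<lambda>x. (cmod (integral {p..x} ?g - m))\<^sup>2)"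
    using ci by (simp add: lebesgue_integral_eq_integral integral_open_interval_real)
  also note m
  also have "integral {p..q} (\<lambda>x. (cmod (?g x))\<^sup>2) = (\<integral>x. (cmod (?g x))\<^sup>2 \<partial>?M)"
    using L2_integrable_square[OF gpq] by (simp add: lebesgue_integral_eq_integral integral_open_interval_real)
  finally show ?thesis by (rule that)
qed

section \<open>The step space and the gap\<close>

lemma sum_integral_disjoint_le:
  fixes \<phi> :: "real \<Rightarrow> real"
  assumes "finite A" and S: "S \<in> sets lebesgue" and Si: "\<And>i. i \<in> A \<Longrightarrow> F i \<in> sets lebesgue" "\<And>i. i \<in> A \<Longrightarrow> F i \<subseteq> S"
    and disj: "disjoint_family_on F A"
    and \<phi>: "integrable (lebesgue_on S) \<phi>" "\<And>x. \<phi> x \<ge> 0"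
  shows "(\<Sum>i\<in>A. \<integral>x. \<phi> x \<partial>lebesgue_on (F i)) \<le> (\<integral>x. \<phi> x \<partial>lebesgue_on S)"
proof -
  have \<phi>S: "\<phi> absolutely_integrable_on S" using \<phi>(1) S by (simp add: integrable_lebesgue_on_iff)
  have i: "\<phi> absolutely_integrable_on F i" if "i \<in> A" for i
    by (rule set_integrable_subset[OF \<phi>S Si[OF that]])
  have eq: "(\<integral>x. \<phi> x \<partial>lebesgue_on U) = (\<integral>x. indicator U x * \<phi> x \<partial>lebesgue)" if "U \<in> sets lebesgue" for U
    using that by (simp add: integral_restrict_space)
  have "(\<Sum>i\<in>A. \<integral>x. \<phi> x \<partial>lebesgue_on (F i)) = (\<integral>x. (\<Sum>i\<in>A. indicator (F i) x * \<phi> x) \<partial>lebesgue)"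
    using i Si by (simp add: eq set_integrable_def)
  also have "\<dots> \<le> (\<integral>x. indicator S x * \<phi> x \<partial>lebesgue)"
  proof (rule integral_mono)
    show "(\<Sum>i\<in>A. indicator (F i) x * \<phi> x) \<le> indicator S x * \<phi> x" for x
    proof -
      have "(\<Sum>i\<in>A. indicator (F i) x :: real) = indicator (\<Union>i\<in>A. F i) x"
        using indicator_UN_disjoint[OF assms(1) disj] by metis
      also have "\<dots> \<le> indicator S x" using Si by (auto simp: indicator_def)
      finally show ?thesis using \<phi>(2)[of x] by (simp add: sum_distrib_right[symmetric] mult_right_mono)
    qed
  qed (use i \<phi>S in \<open>auto simp: set_integrable_def\<close>)
  finally show ?thesis using S by (simp add: eq)
qed

text \<open>Overlaps are harmless for an upper bound. The uncovered null set accommodates the end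
  points that open cells and open pieces leave out.\<close>

lemma integral_le_sum_cover:
  fixes \<phi> :: "real \<Rightarrow> real"
  assumes "finite A" and S: "S \<in> sets lebesgue" and Si: "\<And>i. i \<in> A \<Longrightarrow> F i \<in> sets lebesgue" "\<And>i. i \<in> A \<Longrightarrow> F i \<subseteq> S"
    and cov: "negligible (S - (\<Union>i\<in>A. F i))"
    and \<phi>: "integrable (lebesgue_on S) \<phi>" "\<And>x. \<phi> x \<ge> 0"
  shows "(\<integral>x. \<phi> x \<partial>lebesgue_on S) \<le> (\<Sum>i\<in>A. \<integral>x. \<phi> x \<partial>lebesgue_on (F i))"
proof -
  have \<phi>S: "\<phi> absolutely_integrable_on S" using \<phi>(1) S by (simp add: integrable_lebesgue_on_iff)
  have i: "\<phi> absolutely_integrable_on F i" if "i \<in> A" for i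
    by (rule set_integrable_subset[OF \<phi>S Si[OF that]])
  have eq: "(\<integral>x. \<phi> x \<partial>lebesgue_on U) = (\<integral>x. indicator U x * \<phi> x \<partial>lebesgue)" if "U \<in> sets lebesgue" for U
    using that by (simp add: integral_restrict_space)
  have "(\<integral>x. indicator S x * \<phi> x \<partial>lebesgue) \<le> (\<integral>x. (\<Sum>i\<in>A. indicator (F i) x * \<phi> x) \<partial>lebesgue)"
  proof (rule integral_mono_AE)
    have "AE x in lebesgue. x \<notin> S - (\<Union>i\<in>A. F i)"
      using cov by (intro AE_not_in) (simp add: negligible_iff_null_sets)
    then show "AE x in lebesgue. indicator S x * \<phi> x \<le> (\<Sum>i\<in>A. indicator (F i) x * \<phi> x)"
    proof eventually_elim
      case (elim x)
      show ?case
      proof (cases "x \<in> S")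
        case True
        then obtain i where i: "i \<in> A" "x \<in> F i" using elim by blast
        have "indicator (F i) x * \<phi> x \<le> (\<Sum>i\<in>A. indicator (F i) x * \<phi> x)"
          by (rule member_le_sum[OF i(1) _ assms(1)]) (simp add: \<phi>)
        then show ?thesis using True i by simp
      qed (simp add: sum_nonneg \<phi>)
    qed
  qed (use i \<phi>S in \<open>auto simp: set_integrable_def\<close>)
  also have "\<dots> = (\<Sum>i\<in>A. \<integral>x. \<phi> x \<partial>lebesgue_on (F i))"
    using i Si by (simp add: eq set_integrable_def)
  finally show ?thesis using S by (simp add: eq)
qed

section \<open>The uniform grid and its step functions\<close>

definition cell :: "nat \<Rightarrow> nat \<Rightarrow> real set" where
  "cell L l = {real l / real L ..< (real l + 1) / real L}"

lemma cell_unique: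
  assumes "L \<ge> 1" "x \<in> cell L l" "x \<in> cell L m"
  shows "l = m"
proof -
  have "real l < real m + 1" "real m < real l + 1"
    using assms by (auto simp: cell_def field_simps)
  then show ?thesis by linarith
qed

lemma cell_cover:
  assumes "L \<ge> 1" "0 \<le> x" "x < 1"
  shows "\<exists>l<L. x \<in> cell L l"
proof (intro exI conjI)
  have L: "real L > 0" using assms by simp
  have nn: "0 \<le> x * real L" using assms by simp
  have lt: "x * real L < real L" using assms L by simp
  have f: "real (nat \<lfloor>x * real L\<rfloor>) = of_int \<lfloor>x * real L\<rfloor>" using nn by simp
  show "x \<in> cell L (nat \<lfloor>x * real L\<rfloor>)"
    unfolding cell_def f using L by (auto simp: field_simps) linarith+
  show "nat \<lfloor>x * real L\<rfloor> < L" using lt nn by linarith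
qed

lemma cell_measurable [measurable]: "cell L l \<in> sets borel"
  by (simp add: cell_def)

lemma sum_indicator_cell:
  assumes "L \<ge> 1" "l < L" "x \<in> cell L l"
  shows "(\<Sum>m<L. c m * indicator (cell L m) x) = (c l :: complex)"
proof -
  have "(\<Sum>m<L. c m * indicator (cell L m) x) = (\<Sum>m<L. if m = l then c m else 0)"
  proof (rule sum.cong)
    fix m
    have "indicator (cell L m) x = (if m = l then 1 else (0 :: complex))"
      using cell_unique[OF assms(1), of x m l] assms(3) by (cases "m = l") (auto simp: indicator_def)
    then show "c m * indicator (cell L m) x = (if m = l then c m else 0)" by simp
  qed simp
  then show ?thesis using assms(2) by simp
qed

lemma indicator_L2:
  assumes "A \<in> sets borel"
  shows "(\<lambda>x. indicator A x :: complex) \<in> L2 {0<..<1}"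
proof -
  interpret finite_measure "lebesgue_on {0<..<1::real}" by (simp add: finite_measure_lebesgue_on)
  have [measurable]: "(\<lambda>x. indicator A x :: complex) \<in> borel_measurable (lebesgue_on {0<..<1})"
    using assms by (intro measurable_restrict_space1 measurable_completion) simp
  have "integrable (lebesgue_on {0<..<1}) (\<lambda>x. (cmod (indicator A x))\<^sup>2)"
  proof (rule Bochner_Integration.integrable_bound[of _ "\<lambda>x. 1 :: real"])
    show "AE x in lebesgue_on {0<..<1}. norm ((cmod (indicator A x))\<^sup>2) \<le> norm (1 :: real)"
      by (intro AE_I2) (simp add: indicator_def)
  qed (simp, measurable)
  then show ?thesis by (simp add: L2_def)
qed

lemma step_function_L2: "(\<lambda>x. \<Sum>l<L. c l * indicator (cell L l) x) \<in> L2 {0<..<1}"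
  by (intro L2_sum L2_cmult indicator_L2 cell_measurable) simp

lemma step_function_in_step_space:
  assumes "L \<ge> 1"
  shows "(\<lambda>x. \<Sum>l<L. c l * indicator (cell L l) x) \<in> step_space L"
  unfolding step_space_def cell_def[symmetric]
proof (intro CollectI conjI allI impI step_function_L2)
  fix l assume l: "l < L"
  show "\<exists>d. AE x in lebesgue_on {0<..<1}. x \<in> cell L l \<longrightarrow> (\<Sum>m<L. c m * indicator (cell L m) x) = d"
    by (intro exI[of _ "c l"] AE_I2 impI sum_indicator_cell[OF assms l])
qed

lemma step_space_subspace: "L2_subspace {0<..<1} (step_space L)"
  unfolding L2_subspace_def
proof (intro conjI ballI allI impI)
  show "step_space L \<subseteq> L2 {0<..<1}" by (auto simp: step_space_def)
  show "(\<lambda>x. 0) \<in> step_space L" by (auto simp: step_space_def L2_zero)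
next
  fix f g assume f: "f \<in> step_space L" and g: "g \<in> step_space L"
  show "(\<lambda>x. f x + g x) \<in> step_space L"
    unfolding step_space_def cell_def[symmetric]
  proof (intro CollectI conjI allI impI)
    show "(\<lambda>x. f x + g x) \<in> L2 {0<..<1}" using f g by (intro L2_add) (auto simp: step_space_def)
    fix l assume "l < L"
    then obtain c d where "AE x in lebesgue_on {0<..<1}. x \<in> cell L l \<longrightarrow> f x = c"
      "AE x in lebesgue_on {0<..<1}. x \<in> cell L l \<longrightarrow> g x = d"
      using f g unfolding step_space_def cell_def[symmetric] by blast
    then have "AE x in lebesgue_on {0<..<1}. x \<in> cell L l \<longrightarrow> f x + g x = c + d"
      by eventually_elim simp
    then show "\<exists>c. AE x in lebesgue_on {0<..<1}. x \<in> cell L l \<longrightarrow> f x + g x = c" by blast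
  qed
next
  fix c f assume f: "f \<in> step_space L"
  show "(\<lambda>x. c * f x) \<in> step_space L"
    unfolding step_space_def cell_def[symmetric]
  proof (intro CollectI conjI allI impI)
    show "(\<lambda>x. c * f x) \<in> L2 {0<..<1}" using f by (intro L2_cmult) (auto simp: step_space_def)
    fix l assume "l < L"
    then obtain d where "AE x in lebesgue_on {0<..<1}. x \<in> cell L l \<longrightarrow> f x = d"
      using f unfolding step_space_def cell_def[symmetric] by blast
    then have "AE x in lebesgue_on {0<..<1}. x \<in> cell L l \<longrightarrow> c * f x = c * d"
      by eventually_elim simp
    then show "\<exists>d. AE x in lebesgue_on {0<..<1}. x \<in> cell L l \<longrightarrow> c * f x = d" by blast
  qed
next
  fix f g assume f: "f \<in> step_space L" and g: "g \<in> L2 {0<..<1}"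
    and ae: "AE x in lebesgue_on {0<..<1}. f x = g x"
  show "g \<in> step_space L"
    unfolding step_space_def cell_def[symmetric]
  proof (intro CollectI conjI allI impI g)
    fix l assume "l < L"
    then obtain d where "AE x in lebesgue_on {0<..<1}. x \<in> cell L l \<longrightarrow> f x = d"
      using f unfolding step_space_def cell_def[symmetric] by blast
    then have "AE x in lebesgue_on {0<..<1}. x \<in> cell L l \<longrightarrow> g x = d"
      using ae by eventually_elim simp
    then show "\<exists>d. AE x in lebesgue_on {0<..<1}. x \<in> cell L l \<longrightarrow> g x = d" by blast
  qed
qed

text \<open>\<open>L2_finite_dim\<close> attaches coefficients to the basis functions themselves,
  not to indices, so the indicators must be distinct functions and the index is recovered by
  \<open>inv_into\<close>.\<close>

lemma step_space_finite_dim: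
  assumes L: "L \<ge> 1"
  shows "L2_finite_dim {0<..<1} (step_space L)"
proof -
  define e where "e l = (\<lambda>x. indicator (cell L l) x :: complex)" for l
  have inj: "inj_on e {..<L}"
  proof (rule inj_onI)
    fix l m assume "l \<in> {..<L}" "m \<in> {..<L}" "e l = e m"
    have "real l / real L \<in> cell L l" using L by (auto simp: cell_def field_simps)
    moreover from this have "e m (real l / real L) = 1"
      using fun_cong[OF \<open>e l = e m\<close>, of "real l / real L"] by (simp add: e_def)
    ultimately show "l = m"
      using cell_unique[OF L] by (auto simp: e_def indicator_def split: if_splits)
  qed
  have sub: "e ` {..<L} \<subseteq> step_space L"
  proof clarify
    fix l assume "l < L"
    have "e l = (\<lambda>x. \<Sum>m<L. (if m = l then 1 else 0) * indicator (cell L m) x)"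
    proof
      fix x
      have "(\<Sum>m<L. (if m = l then 1 else 0) * indicator (cell L m) x)
          = (\<Sum>m<L. if m = l then indicator (cell L m) x else (0::complex))"
        by (rule sum.cong) auto
      then show "e l x = (\<Sum>m<L. (if m = l then 1 else 0) * indicator (cell L m) x)"
        using \<open>l < L\<close> by (simp add: e_def)
    qed
    then show "e l \<in> step_space L" using step_function_in_step_space[OF L] by metis
  qed
  have "\<exists>c. AE x in lebesgue_on {0<..<1}. f x = (\<Sum>b\<in>e ` {..<L}. c b * b x)" if f: "f \<in> step_space L" for f
  proof -
    have "\<forall>l. \<exists>c. l < L \<longrightarrow> (AE x in lebesgue_on {0<..<1}. x \<in> cell L l \<longrightarrow> f x = c)"
      using f unfolding step_space_def cell_def[symmetric] by blast
    from choice[OF this] obtain d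
      where d: "\<forall>l. l < L \<longrightarrow> (AE x in lebesgue_on {0<..<1}. x \<in> cell L l \<longrightarrow> f x = d l)" ..
    have "AE x in lebesgue_on {0<..<1}. \<forall>l\<in>{..<L}. x \<in> cell L l \<longrightarrow> f x = d l"
      using d by (intro AE_finite_allI) auto
    then have "AE x in lebesgue_on {0<..<1}. f x = (\<Sum>b\<in>e ` {..<L}. (d (inv_into {..<L} e b)) * b x)"
      using AE_space
    proof eventually_elim
      case (elim x)
      obtain l where l: "l < L" "x \<in> cell L l" using cell_cover[OF L, of x] elim(2) by auto
      have "(\<Sum>b\<in>e ` {..<L}. (d (inv_into {..<L} e b)) * b x) = (\<Sum>m<L. d m * indicator (cell L m) x)"
      proof (subst sum.reindex[OF inj], rule sum.cong)
        fix m assume "m \<in> {..<L}"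
        then show "((\<lambda>b. d (inv_into {..<L} e b) * b x) \<circ> e) m = d m * indicator (cell L m) x"
          by (simp only: o_def inv_into_f_f[OF inj]) (simp add: e_def)
      qed simp
      also have "\<dots> = d l" by (rule sum_indicator_cell[OF L l])
      finally show ?case using elim(1) l by auto
    qed
    then show ?thesis by (rule exI[where x = "\<lambda>b. d (inv_into {..<L} e b)"])
  qed
  then show ?thesis unfolding L2_finite_dim_def using sub by (intro exI[of _ "e ` {..<L}"]) auto
qed

text \<open>The projection onto \<open>V\<close> does not increase the norm, and the projection onto
  \<open>U\<close> is at least as good as any competitor. The hypothesis is in squares because
  errors on different cells add up in squares.\<close>

lemma gap_le:
  assumes U: "L2_subspace {0<..<1} U" "L2_finite_dim {0<..<1} U"
    and V: "L2_subspace {0<..<1} V" "L2_finite_dim {0<..<1} V"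
    and c: "c \<ge> 0"
    and approx: "\<And>v. v \<in> V \<Longrightarrow> \<exists>u\<in>U. (L2_norm {0<..<1} (\<lambda>x. v x - u x))\<^sup>2 \<le> c * (L2_norm {0<..<1} v)\<^sup>2"
  shows "gap U V \<le> sqrt c"
  unfolding gap_def Let_def L2_onorm_def
proof (rule cSUP_least)
  let ?I = "{0<..<1::real}"
  show "{f \<in> L2 ?I. L2_norm ?I f \<le> 1} \<noteq> {}"
    using L2_zero[of ?I] L2_norm_zero[of ?I] by (metis (no_types, lifting) empty_iff mem_Collect_eq zero_le_one)
  fix f assume "f \<in> {f \<in> L2 ?I. L2_norm ?I f \<le> 1}"
  then have f: "f \<in> L2 ?I" "L2_norm ?I f \<le> 1" by auto
  define v where "v = L2_proj ?I V f"
  have vV: "v \<in> V" unfolding v_def by (rule L2_proj[OF V f(1)])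
  then have vL: "v \<in> L2 ?I" using V by (auto simp: L2_subspace_def)
  have v1: "L2_norm ?I v \<le> 1" using L2_proj_norm_le[OF V f(1)] f(2) by (simp add: v_def)
  obtain u where u: "u \<in> U" "(L2_norm ?I (\<lambda>x. v x - u x))\<^sup>2 \<le> c * (L2_norm ?I v)\<^sup>2"
    using approx[OF vV] by blast
  have "L2_norm ?I (\<lambda>x. v x - L2_proj ?I U v x) \<le> L2_norm ?I (\<lambda>x. v x - u x)"
    by (rule L2_proj_best_approximation[OF U vL u(1)])
  also have "\<dots> \<le> sqrt c"
  proof (rule real_le_rsqrt)
    have "c * (L2_norm ?I v)\<^sup>2 \<le> c * 1"
      using v1 c by (intro mult_left_mono power_le_one L2_norm_nonneg)
    then show "(L2_norm ?I (\<lambda>x. v x - u x))\<^sup>2 \<le> c" using u(2) by simp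
  qed
  finally show "L2_norm ?I (\<lambda>x. L2_proj ?I V f x - L2_proj ?I U (L2_proj ?I V f) x) \<le> sqrt c"
    unfolding v_def .
qed

text \<open>By homogeneity one normalises \<open>f\<close> on the piece. Functions of norm 0 on the
  piece escape the supremum; for them the derivative seminorm vanishes by
  \<open>D_norm_null\<close>.\<close>

lemma gamma_const_bound:
  assumes T: "L2_subspace {0<..<1} T" "L2_finite_dim {0<..<1} T" and TH: "T \<subseteq> H1_pw k w"
    and w: "\<And>j. j \<le> k \<Longrightarrow> {w j<..<w (Suc j)} \<subseteq> {0<..<1}"
    and f: "f \<in> T" and j: "j \<le> k"
  shows "D_norm {w j<..<w (Suc j)} f \<le> enn2real (gamma_const k w T) * L2_norm {w j<..<w (Suc j)} f"
proof -
  define S where "S i = (SUP f\<in>{f \<in> T. L2_norm {w i<..<w (Suc i)} f = 1}. ennreal (D_norm {w i<..<w (Suc i)} f))" for i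
  have g: "gamma_const k w T = (MAX i\<in>{..k}. S i)" by (simp add: gamma_const_def S_def Let_def)
  have H: "T \<subseteq> H1 {w i<..<w (Suc i)}" if "i \<le> k" for i using TH that by (auto simp: H1_pw_def)
  have fin: "S i < top" if i: "i \<le> k" for i
  proof -
    obtain K where K: "K \<ge> 0" "\<And>f. f \<in> T \<Longrightarrow> D_norm {w i<..<w (Suc i)} f \<le> K * L2_norm {w i<..<w (Suc i)} f"
      using finite_dim_D_norm_bound[OF T H[OF i] w[OF i]] by auto
    have "S i \<le> ennreal K"
      unfolding S_def
    proof (rule SUP_least)
      fix f assume "f \<in> {f \<in> T. L2_norm {w i<..<w (Suc i)} f = 1}"
      then show "ennreal (D_norm {w i<..<w (Suc i)} f) \<le> ennreal K"
        using K(2)[of f] by (intro ennreal_leI) auto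
    qed
    then show ?thesis using ennreal_less_top le_less_trans by blast
  qed
  have top: "gamma_const k w T < top" unfolding g using fin by (subst Max_less_iff) auto
  define \<gamma> where "\<gamma> = enn2real (gamma_const k w T)"
  let ?I = "{w j<..<w (Suc j)}"
  have fH: "f \<in> H1 ?I" using H j f by blast
  have "D_norm ?I f \<le> \<gamma> * L2_norm ?I f"
  proof (cases "L2_norm ?I f = 0")
    case True
    then show ?thesis using D_norm_null[OF fH] by simp
  next
    case False
    then have n: "L2_norm ?I f > 0" using L2_norm_nonneg[of ?I f] by simp
    define c where "c = complex_of_real (1 / L2_norm ?I f)"
    have cf: "(\<lambda>x. c * f x) \<in> T" using T(1) f by (rule L2_subspace_cmult)
    have cn: "cmod c = 1 / L2_norm ?I f" using n by (simp add: c_def norm_divide)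
    have "L2_norm ?I (\<lambda>x. c * f x) = 1" using n by (simp add: L2_norm_cmult cn)
    then have "ennreal (D_norm ?I (\<lambda>x. c * f x)) \<le> S j"
      unfolding S_def using cf by (intro SUP_upper) auto
    also have "\<dots> \<le> gamma_const k w T" unfolding g using j by (intro Max_ge) auto
    finally have "enn2real (ennreal (D_norm ?I (\<lambda>x. c * f x))) \<le> \<gamma>"
      unfolding \<gamma>_def using top by (intro enn2real_mono) auto
    then have "D_norm ?I (\<lambda>x. c * f x) \<le> \<gamma>" by (simp add: L2_norm_nonneg)
    then show ?thesis using n by (simp add: D_norm_cmult[OF fH] cn field_simps)
  qed
  then show ?thesis by (simp add: \<gamma>_def)
qed

text \<open>Functions of norm 1 on a piece have derivative norm at most \<gamma>, so
  \<open>H1_bounded\<close> bounds all of them uniformly; homogeneity does the rest.\<close>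

lemma zeta_const_bound:
  assumes T: "L2_subspace {0<..<1} T" "L2_finite_dim {0<..<1} T" and TH: "T \<subseteq> H1_pw k w"
    and w: "\<And>j. j \<le> k \<Longrightarrow> {w j<..<w (Suc j)} \<subseteq> {0<..<1}" and wl: "\<And>j. j \<le> k \<Longrightarrow> w j < w (Suc j)"
    and f: "f \<in> T" and j: "j \<le> k"
  shows "AE x in lebesgue_on {w j<..<w (Suc j)}.
    cmod (f x) \<le> enn2real (zeta_const k w T) * L2_norm {w j<..<w (Suc j)} f"
proof -
  define N where "N i f = esssup (lebesgue_on {w i<..<w (Suc i)}) (\<lambda>x. ennreal (cmod (f x)))" for i and f :: "real \<Rightarrow> complex"
  define S where "S i = (SUP f\<in>{f \<in> T. L2_norm {w i<..<w (Suc i)} f = 1}. N i f)" for i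
  have g: "zeta_const k w T = (MAX i\<in>{..k}. S i)" by (simp add: zeta_const_def S_def N_def Let_def)
  have H: "T \<subseteq> H1 {w i<..<w (Suc i)}" if "i \<le> k" for i using TH that by (auto simp: H1_pw_def)
  have fin: "S i < top" if i: "i \<le> k" for i
  proof -
    let ?a = "w i" and ?b = "w (Suc i)"
    define \<Gamma> where "\<Gamma> = enn2real (gamma_const k w T)"
    define R where "R = (?b - ?a + 1) / (?b - ?a) + 2 * ((?b - ?a) + \<Gamma>\<^sup>2)"
    have "S i \<le> ennreal R"
      unfolding S_def
    proof (rule SUP_least)
      fix f assume f: "f \<in> {f \<in> T. L2_norm {?a<..<?b} f = 1}"
      then have fH: "f \<in> H1 {?a<..<?b}" using H[OF i] by blast
      have d: "D_norm {?a<..<?b} f \<le> \<Gamma>"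
        using gamma_const_bound[OF T TH w _ i, of f] f by (simp add: \<Gamma>_def)
      have ae: "AE x in lebesgue_on {?a<..<?b}. cmod (f x) \<le> R"
        unfolding R_def by (rule H1_bounded[OF wl[OF i] fH _ d]) (use f in auto)
      have [measurable]: "f \<in> borel_measurable (lebesgue_on {?a<..<?b})"
        by (rule L2_measurable[OF H1_L2[OF fH]])
      show "N i f \<le> ennreal R"
        unfolding N_def
      proof (rule esssup_I)
        show "AE x in lebesgue_on {?a<..<?b}. ennreal (cmod (f x)) \<le> ennreal R"
          using ae by eventually_elim (rule ennreal_leI)
      qed measurable
    qed
    then show ?thesis using ennreal_less_top le_less_trans by blast
  qed
  have top: "zeta_const k w T < top" unfolding g using fin by (subst Max_less_iff) auto
  define \<zeta> where "\<zeta> = enn2real (zeta_const k w T)"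
  let ?I = "{w j<..<w (Suc j)}"
  have fL: "f \<in> L2 ?I" using H j f H1_L2 by blast
  have "AE x in lebesgue_on ?I. cmod (f x) \<le> \<zeta> * L2_norm ?I f"
  proof (cases "L2_norm ?I f = 0")
    case True
    show ?thesis using L2_norm_eq_0[OF fL True] by eventually_elim (simp add: True)
  next
    case False
    then have n: "L2_norm ?I f > 0" using L2_norm_nonneg[of ?I f] by simp
    define c where "c = complex_of_real (1 / L2_norm ?I f)"
    have cf: "(\<lambda>x. c * f x) \<in> T" using T(1) f by (rule L2_subspace_cmult)
    have cn: "cmod c = 1 / L2_norm ?I f" using n by (simp add: c_def norm_divide)
    have "L2_norm ?I (\<lambda>x. c * f x) = 1" using n by (simp add: L2_norm_cmult cn)
    then have "N j (\<lambda>x. c * f x) \<le> S j"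
      unfolding S_def using cf by (intro SUP_upper) auto
    also have "\<dots> \<le> zeta_const k w T" unfolding g using j by (intro Max_ge) auto
    finally have le: "N j (\<lambda>x. c * f x) \<le> zeta_const k w T" .
    have "AE x in lebesgue_on ?I. ennreal (cmod (c * f x)) \<le> N j (\<lambda>x. c * f x)"
      unfolding N_def by (rule esssup_AE)
    then show ?thesis
    proof eventually_elim
      case (elim x)
      then have "ennreal (cmod (c * f x)) \<le> zeta_const k w T" using le by (rule order_trans)
      then have "enn2real (ennreal (cmod (c * f x))) \<le> \<zeta>"
        unfolding \<zeta>_def using top by (intro enn2real_mono) auto
      then show ?case using n by (simp add: norm_mult cn field_simps)
    qed
  qed
  then show ?thesis by (simp add: \<zeta>_def)
qed

section \<open>The nodes and the approximating step function\<close>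

lemma partition_mono:
  fixes w :: "nat \<Rightarrow> real"
  assumes "\<And>j. j \<le> k \<Longrightarrow> w j < w (Suc j)" "i \<le> j" "j \<le> Suc k"
  shows "w i \<le> w j"
  using assms(2,3)
proof (induction rule: dec_induct)
  case (step n)
  then show ?case using assms(1)[of n] by simp
qed simp

lemma partition_locate:
  fixes w :: "nat \<Rightarrow> real"
  assumes "w 0 \<le> x" "x < w (Suc k)"
  shows "\<exists>j\<le>k. w j \<le> x \<and> x < w (Suc j)"
  using assms
proof (induction k)
  case (Suc k)
  then show ?case by (cases "x < w (Suc k)") (auto intro: le_SucI)
qed auto

text \<open>The conditional term serves both claims of the theorem: for k = 0 no cell contains an
  interior node, and only the mean-value error remains.\<close>

lemma step_approximation:
  fixes w :: "nat \<Rightarrow> real"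
  assumes w0: "w 0 = 0" and w1: "w (Suc k) = 1" and wl: "\<And>j. j \<le> k \<Longrightarrow> w j < w (Suc j)"
    and L: "L \<ge> 1"
    and T: "L2_subspace {0<..<1} T" "L2_finite_dim {0<..<1} T" and TH: "T \<subseteq> H1_pw k w"
    and t: "t \<in> T"
  defines "\<gamma> \<equiv> enn2real (gamma_const k w T)"
    and "\<zeta> \<equiv> enn2real (zeta_const k w T)"
  shows "\<exists>s\<in>step_space L. (L2_norm {0<..<1} (\<lambda>x. t x - s x))\<^sup>2
    \<le> (\<gamma>\<^sup>2 / (pi * real L)\<^sup>2 + (if k = 0 then 0 else 4 * \<zeta>\<^sup>2 / real L)) * (L2_norm {0<..<1} t)\<^sup>2"
proof -
  define U where "U = {0<..<1::real}"
  define I where "I j = {w j<..<w (Suc j)}" for j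
  \<comment> \<open>Open cells differ from \<open>cell\<close> by the left end point only. Openness
    makes a node on the boundary of a cell harmless.\<close>
  define J where "J l = {real l / real L<..<(real l + 1) / real L}" for l
  have Lpos: "real L > 0" using L by simp
  have mono: "w i \<le> w j" if "i \<le> j" "j \<le> Suc k" for i j
    using partition_mono[of k w i j] wl that by blast
  have IU: "I j \<subseteq> U" if "j \<le> k" for j
    using mono[of 0 j] mono[of "Suc j" "Suc k"] that w0 w1 by (auto simp: I_def U_def)
  have JU: "J l \<subseteq> U" if "l < L" for l
  proof -
    have "(real l + 1) / real L \<le> 1" using that Lpos by (simp add: field_simps)
    moreover have "0 \<le> real l / real L" by simp
    ultimately show ?thesis
      unfolding J_def U_def by (intro subsetI) (simp only: greaterThanLessThan_iff, linarith)
  qed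
  have Jcell: "J l \<subseteq> cell L l" for l by (auto simp: J_def cell_def)
  have meas [simp]: "U \<in> sets lebesgue" "I j \<in> sets lebesgue" "J l \<in> sets lebesgue" for j l
    by (simp_all add: U_def I_def J_def)
  have disjI: "disjoint_family_on I {..k}"
    unfolding disjoint_family_on_def
  proof (intro ballI impI)
    have *: "I i \<inter> I j = {}" if "i < j" "j \<le> k" for i j
      using mono[of "Suc i" j] that by (auto simp: I_def)
    fix i j assume "i \<in> {..k}" "j \<in> {..k}" "i \<noteq> j"
    then show "I i \<inter> I j = {}" using *[of i j] *[of j i] by (cases "i < j") auto
  qed
  have disjJ: "disjoint_family_on J A" for A
    unfolding disjoint_family_on_def using cell_unique[OF L] Jcell by blast
  have tU: "t \<in> L2 U" using t T(1) by (auto simp: L2_subspace_def U_def)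
  have tH: "t \<in> H1 (I j)" if "j \<le> k" for j using t TH that by (auto simp: H1_pw_def I_def)
  have t2: "integrable (lebesgue_on S) (\<lambda>x. (cmod (t x))\<^sup>2)" if "S \<subseteq> U" "S \<in> sets lebesgue" for S
    using L2_subset[OF tU that] by (simp add: L2_integrable_square)
  define n where "n j = (L2_norm (I j) t)\<^sup>2" for j
  have nn: "n j \<ge> 0" for j by (simp add: n_def)
  have sum_n: "(\<Sum>j\<le>k. n j) \<le> (L2_norm U t)\<^sup>2"
    unfolding n_def L2_norm_square
    by (rule sum_integral_disjoint_le) (use IU disjI t2 in auto)

  \<comment> \<open>The good cells; \<open>Bd\<close> collects the bad ones. The outer nodes 0 and 1
    lie in no open cell, so only the interior nodes count.\<close>
  define G where "G = {l. l < L \<and> (\<forall>j\<in>{1..k}. w j \<notin> J l)}"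
  define Bd where "Bd = {..<L} - G"
  have GL: "G \<subseteq> {..<L}" by (auto simp: G_def)
  have finG: "finite G" "finite Bd" using finite_subset[OF GL] by (auto simp: Bd_def)
  \<comment> \<open>Locate the left end of the cell in a piece. The next node is to the right of
    that end but not inside the cell, hence not left of its right end.\<close>
  have "\<exists>j\<le>k. J l \<subseteq> I j" if l: "l \<in> G" for l
  proof -
    have lL: "l < L" using l by (simp add: G_def)
    have "0 \<le> real l / real L" "real l / real L < 1" using lL Lpos by (simp_all add: field_simps)
    then obtain j where j: "j \<le> k" "w j \<le> real l / real L" "real l / real L < w (Suc j)"
      using partition_locate[of w "real l / real L" k] w0 w1 by auto
    have "(real l + 1) / real L \<le> w (Suc j)"
    proof (cases "j = k")
      case True
      then show ?thesis using w1 lL Lpos by (simp add: field_simps)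
    next
      case False
      then have "w (Suc j) \<notin> J l" using l j by (auto simp: G_def)
      then show ?thesis using j by (simp add: J_def)
    qed
    then have "J l \<subseteq> I j" using j by (auto simp: J_def I_def)
    then show ?thesis using j by blast
  qed
  then obtain jj where jj: "\<And>l. l \<in> G \<Longrightarrow> jj l \<le> k \<and> J l \<subseteq> I (jj l)" by metis
  define g where "g j = weak_deriv (I j) t" for j
  \<comment> \<open>The Wirtinger constant of an interval of length 1/L. Including c = 0 off
    \<open>G\<close> in the next statement lets one choice of c define the step function on all
    cells.\<close>
  define h where "h = 1 / (pi * real L)"
  have "\<exists>c. (l \<in> G \<longrightarrow> (\<integral>x. (cmod (t x - c))\<^sup>2 \<partial>lebesgue_on (J l))
        \<le> h\<^sup>2 * (\<integral>x. (cmod (g (jj l) x))\<^sup>2 \<partial>lebesgue_on (J l))) \<and> (l \<notin> G \<longrightarrow> c = 0)" for l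
  proof (cases "l \<in> G")
    case True
    let ?p = "real l / real L" and ?q = "(real l + 1) / real L"
    have pq: "?p < ?q" using Lpos by (simp add: divide_strict_right_mono)
    have sub: "{?p<..<?q} \<subseteq> {w (jj l)<..<w (Suc (jj l))}" using jj[OF True] by (simp add: J_def I_def)
    have e: "w (jj l) \<le> ?p" "?q \<le> w (Suc (jj l))"
      using sub pq greaterThanLessThan_subseteq_greaterThanLessThan[of ?p ?q] by auto
    obtain c where "(\<integral>x. (cmod (t x - c))\<^sup>2 \<partial>lebesgue_on {?p<..<?q})
      \<le> ((?q - ?p) / pi)\<^sup>2 * (\<integral>x. (cmod (weak_deriv {w (jj l)<..<w (Suc (jj l))} t x))\<^sup>2 \<partial>lebesgue_on {?p<..<?q})"
      using H1_wirtinger_subinterval[OF tH[unfolded I_def] e(1) pq e(2)] jj[OF True] by blast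
    moreover have "(?q - ?p) / pi = h" by (simp add: h_def diff_divide_distrib[symmetric])
    ultimately show ?thesis using True by (auto simp: J_def g_def I_def)
  qed auto
  then obtain c where c: "\<And>l. l \<in> G \<Longrightarrow> (\<integral>x. (cmod (t x - c l))\<^sup>2 \<partial>lebesgue_on (J l))
        \<le> h\<^sup>2 * (\<integral>x. (cmod (g (jj l) x))\<^sup>2 \<partial>lebesgue_on (J l))"
      and c0: "\<And>l. l \<notin> G \<Longrightarrow> c l = 0" by metis
  define s where "s x = (\<Sum>l<L. c l * indicator (cell L l) x)" for x
  have sS: "s \<in> step_space L" unfolding s_def[abs_def] by (rule step_function_in_step_space[OF L])
  then have sU: "s \<in> L2 U" by (simp add: step_space_def U_def)
  have dU: "(\<lambda>x. t x - s x) \<in> L2 U" by (rule L2_diff[OF tU sU])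

  have "(L2_norm U (\<lambda>x. t x - s x))\<^sup>2 \<le> (\<Sum>l<L. \<integral>x. (cmod (t x - s x))\<^sup>2 \<partial>lebesgue_on (J l))"
    unfolding L2_norm_square
  proof (rule integral_le_sum_cover)
    have "U - (\<Union>l\<in>{..<L}. J l) \<subseteq> (\<lambda>l. real l / real L) ` {..<L}"
    proof
      fix x assume x: "x \<in> U - (\<Union>l\<in>{..<L}. J l)"
      then obtain l where l: "l < L" "x \<in> cell L l" using cell_cover[OF L, of x] by (auto simp: U_def)
      with x show "x \<in> (\<lambda>l. real l / real L) ` {..<L}" by (force simp: cell_def J_def)
    qed
    then show "negligible (U - (\<Union>l\<in>{..<L}. J l))"
      by (rule negligible_subset[rotated]) (simp add: negligible_finite)
  qed (use JU L2_integrable_square[OF dU] in auto)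
  also have "\<dots> = (\<Sum>l<L. \<integral>x. (cmod (t x - c l))\<^sup>2 \<partial>lebesgue_on (J l))"
  proof (intro sum.cong refl Bochner_Integration.integral_cong)
    fix l x assume "l \<in> {..<L}" "x \<in> space (lebesgue_on (J l))"
    then have "s x = c l" unfolding s_def using Jcell[of l] by (intro sum_indicator_cell[OF L]) auto
    then show "(cmod (t x - s x))\<^sup>2 = (cmod (t x - c l))\<^sup>2" by simp
  qed
  also have "\<dots> = (\<Sum>l\<in>Bd. \<integral>x. (cmod (t x - c l))\<^sup>2 \<partial>lebesgue_on (J l))
      + (\<Sum>l\<in>G. \<integral>x. (cmod (t x - c l))\<^sup>2 \<partial>lebesgue_on (J l))"
    unfolding Bd_def by (rule sum.subset_diff[OF GL]) simp
  also have "(\<Sum>l\<in>Bd. \<integral>x. (cmod (t x - c l))\<^sup>2 \<partial>lebesgue_on (J l))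
      = (\<Sum>l\<in>Bd. \<integral>x. (cmod (t x))\<^sup>2 \<partial>lebesgue_on (J l))"
    by (rule sum.cong) (auto simp: Bd_def c0)
  finally have split: "(L2_norm U (\<lambda>x. t x - s x))\<^sup>2 \<le> (\<Sum>l\<in>Bd. \<integral>x. (cmod (t x))\<^sup>2 \<partial>lebesgue_on (J l))
      + (\<Sum>l\<in>G. \<integral>x. (cmod (t x - c l))\<^sup>2 \<partial>lebesgue_on (J l))" .

  have good: "(\<Sum>l\<in>G. \<integral>x. (cmod (t x - c l))\<^sup>2 \<partial>lebesgue_on (J l)) \<le> \<gamma>\<^sup>2 / (pi * real L)\<^sup>2 * (L2_norm U t)\<^sup>2"
  proof -
    \<comment> \<open>Cells are grouped by the piece containing them; within one piece they are
      disjoint, so their derivative integrals add up to at most the one that \<gamma>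
      controls.\<close>
    have "(\<Sum>l\<in>G. \<integral>x. (cmod (g (jj l) x))\<^sup>2 \<partial>lebesgue_on (J l))
        = (\<Sum>j\<le>k. \<Sum>l\<in>{l \<in> G. jj l = j}. \<integral>x. (cmod (g (jj l) x))\<^sup>2 \<partial>lebesgue_on (J l))"
      by (rule sum.group[symmetric]) (use finG jj in auto)
    also have "\<dots> \<le> (\<Sum>j\<le>k. \<gamma>\<^sup>2 * n j)"
    proof (rule sum_mono)
      fix j assume "j \<in> {..k}"
      then have j: "j \<le> k" by simp
      have gL: "g j \<in> L2 (I j)" using H1_weak_deriv(1) tH[OF j] by (simp add: g_def I_def)
      have "(\<Sum>l\<in>{l \<in> G. jj l = j}. \<integral>x. (cmod (g (jj l) x))\<^sup>2 \<partial>lebesgue_on (J l))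
        = (\<Sum>l\<in>{l \<in> G. jj l = j}. \<integral>x. (cmod (g j x))\<^sup>2 \<partial>lebesgue_on (J l))"
        by (rule sum.cong) auto
      also have "\<dots> \<le> (\<integral>x. (cmod (g j x))\<^sup>2 \<partial>lebesgue_on (I j))"
        by (rule sum_integral_disjoint_le) (use finG jj disjJ L2_integrable_square[OF gL] in auto)
      also have "\<dots> = (L2_norm (I j) (g j))\<^sup>2" by (simp add: L2_norm_square)
      also have "\<dots> \<le> (\<gamma> * L2_norm (I j) t)\<^sup>2"
        using gamma_const_bound[OF T TH IU[unfolded I_def U_def] t j]
        by (intro power_mono L2_norm_nonneg) (simp add: g_def I_def \<gamma>_def)
      also have "\<dots> = \<gamma>\<^sup>2 * n j" by (simp add: n_def power_mult_distrib)
      finally show "(\<Sum>l\<in>{l \<in> G. jj l = j}. \<integral>x. (cmod (g (jj l) x))\<^sup>2 \<partial>lebesgue_on (J l)) \<le> \<gamma>\<^sup>2 * n j" .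
    qed
    also have "\<dots> \<le> \<gamma>\<^sup>2 * (L2_norm U t)\<^sup>2"
      using mult_left_mono[OF sum_n, of "\<gamma>\<^sup>2"] by (simp add: sum_distrib_left)
    finally have "h\<^sup>2 * (\<Sum>l\<in>G. \<integral>x. (cmod (g (jj l) x))\<^sup>2 \<partial>lebesgue_on (J l)) \<le> h\<^sup>2 * (\<gamma>\<^sup>2 * (L2_norm U t)\<^sup>2)"
      by (rule mult_left_mono) simp
    moreover have "(\<Sum>l\<in>G. \<integral>x. (cmod (t x - c l))\<^sup>2 \<partial>lebesgue_on (J l))
        \<le> h\<^sup>2 * (\<Sum>l\<in>G. \<integral>x. (cmod (g (jj l) x))\<^sup>2 \<partial>lebesgue_on (J l))"
      unfolding sum_distrib_left by (rule sum_mono) (rule c)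
    ultimately show ?thesis by (simp add: h_def power_divide)
  qed

  have bad: "(\<Sum>l\<in>Bd. \<integral>x. (cmod (t x))\<^sup>2 \<partial>lebesgue_on (J l)) \<le> 4 * \<zeta>\<^sup>2 / real L * (L2_norm U t)\<^sup>2"
  proof -
    \<comment> \<open>The value 0 for disjoint pairs lets the sum over bad cells, for a fixed piece,
      collapse to the few cells that meet the piece.\<close>
    define q where "q l j = (if J l \<inter> I j = {} then 0 else \<zeta>\<^sup>2 * n j / real L)" for l j
    have piece: "(\<integral>x. (cmod (t x))\<^sup>2 \<partial>lebesgue_on (J l \<inter> I j)) \<le> q l j" if l: "l < L" and j: "j \<le> k" for l j
    proof (cases "J l \<inter> I j = {}")
      case False
      have fm: "J l \<inter> I j \<in> lmeasurable" by (simp add: J_def I_def)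
      interpret finite_measure "lebesgue_on (J l \<inter> I j)" by (rule finite_measure_lebesgue_on[OF fm])
      have "AE x in lebesgue_on (I j). cmod (t x) \<le> \<zeta> * L2_norm (I j) t"
        unfolding \<zeta>_def I_def by (rule zeta_const_bound[OF T TH IU[unfolded I_def U_def] wl t j])
      then have ae: "AE x in lebesgue_on (J l \<inter> I j). cmod (t x) \<le> \<zeta> * L2_norm (I j) t"
        by (rule AE_lebesgue_on_subset) auto
      have "(\<integral>x. (cmod (t x))\<^sup>2 \<partial>lebesgue_on (J l \<inter> I j)) \<le> (\<integral>x. \<zeta>\<^sup>2 * n j \<partial>lebesgue_on (J l \<inter> I j))"
      proof (rule integral_mono_AE)
        show "integrable (lebesgue_on (J l \<inter> I j)) (\<lambda>x. (cmod (t x))\<^sup>2)"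
          by (rule t2) (use JU[OF l] in auto)
        show "AE x in lebesgue_on (J l \<inter> I j). (cmod (t x))\<^sup>2 \<le> \<zeta>\<^sup>2 * n j"
          using ae
        proof eventually_elim
          case (elim x)
          then have "(cmod (t x))\<^sup>2 \<le> (\<zeta> * L2_norm (I j) t)\<^sup>2" by (intro power_mono) auto
          then show ?case by (simp add: n_def power_mult_distrib)
        qed
      qed simp
      also have "\<dots> = measure lebesgue (J l \<inter> I j) * (\<zeta>\<^sup>2 * n j)"
        using sets.Int[OF meas(3)[of l] meas(2)[of j]] by (simp add: measure_restrict_space)
      also have "\<dots> \<le> measure lebesgue (J l) * (\<zeta>\<^sup>2 * n j)"
        by (intro mult_right_mono measure_mono_fmeasurable) (auto simp: nn J_def)
      also have "measure lebesgue (J l) = 1 / real L"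
        using Lpos by (simp add: J_def divide_right_mono diff_divide_distrib[symmetric])
      finally show ?thesis using False by (simp add: q_def)
    qed (simp add: q_def)
    have "(\<Sum>l\<in>Bd. \<integral>x. (cmod (t x))\<^sup>2 \<partial>lebesgue_on (J l)) \<le> (\<Sum>l\<in>Bd. \<Sum>j\<le>k. q l j)"
    proof (rule sum_mono)
      fix l assume "l \<in> Bd"
      then have l: "l < L" by (simp add: Bd_def)
      have "(\<integral>x. (cmod (t x))\<^sup>2 \<partial>lebesgue_on (J l)) \<le> (\<Sum>j\<le>k. \<integral>x. (cmod (t x))\<^sup>2 \<partial>lebesgue_on (J l \<inter> I j))"
      proof (rule integral_le_sum_cover)
        have "J l - (\<Union>j\<in>{..k}. J l \<inter> I j) \<subseteq> w ` {..k}"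
        proof
          fix x assume x: "x \<in> J l - (\<Union>j\<in>{..k}. J l \<inter> I j)"
          then have "0 \<le> x" "x < 1" using JU[OF l] by (auto simp: U_def)
          then obtain j where "j \<le> k" "w j \<le> x" "x < w (Suc j)"
            using partition_locate[of w x k] w0 w1 by auto
          with x show "x \<in> w ` {..k}" by (force simp: I_def)
        qed
        then show "negligible (J l - (\<Union>j\<in>{..k}. J l \<inter> I j))"
          by (rule negligible_subset[rotated]) (simp add: negligible_finite)
      qed (use t2[OF JU[OF l]] in auto)
      also have "\<dots> \<le> (\<Sum>j\<le>k. q l j)" by (rule sum_mono) (use piece[OF l] in auto)
      finally show "(\<integral>x. (cmod (t x))\<^sup>2 \<partial>lebesgue_on (J l)) \<le> (\<Sum>j\<le>k. q l j)" .
    qed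
    \<comment> \<open>One cell may meet many pieces, but each piece meets few bad cells, so the
      cells are counted piece by piece.\<close>
    also have "\<dots> = (\<Sum>j\<le>k. \<Sum>l\<in>Bd. q l j)" by (rule sum.swap)
    also have "\<dots> \<le> (\<Sum>j\<le>k. 4 * \<zeta>\<^sup>2 / real L * n j)"
    proof (rule sum_mono)
      fix j assume "j \<in> {..k}"
      then have j: "j \<le> k" by simp
      define V where "V = {l \<in> Bd. J l \<inter> I j \<noteq> {}}"
      have at_most_one: "card {l. x \<in> J l} \<le> 1 \<and> finite {l. x \<in> J l}" for x
      proof -
        have "{l. x \<in> J l} = {} \<or> (\<exists>l. {l. x \<in> J l} = {l})"
          using cell_unique[OF L] Jcell by blast
        then show ?thesis by auto
      qed
      \<comment> \<open>A bad cell contains some node w i. If it also meets piece j, it is an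
        interval reaching from that piece to w i, so it contains the end point of the piece on the
        side of w i.\<close>
      have "V \<subseteq> {l. w j \<in> J l} \<union> {l. w (Suc j) \<in> J l}"
      proof
        fix l assume l: "l \<in> V"
        then obtain i where i: "i \<le> k" "w i \<in> J l" by (auto simp: V_def Bd_def G_def)
        obtain y where y: "y \<in> J l" "y \<in> I j" using l by (auto simp: V_def)
        show "l \<in> {l. w j \<in> J l} \<union> {l. w (Suc j) \<in> J l}"
        proof (cases "i \<le> j")
          case True
          then have "w i \<le> w j" using mono j by simp
          then have "w j \<in> J l" using i y by (auto simp: J_def I_def)
          then show ?thesis by simp
        next
          case False
          then have "w (Suc j) \<le> w i" using mono i by simp
          then have "w (Suc j) \<in> J l" using i y by (auto simp: J_def I_def)
          then show ?thesis by simp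
        qed
      qed
      then have "card V \<le> card ({l. w j \<in> J l} \<union> {l. w (Suc j) \<in> J l})"
        using at_most_one by (intro card_mono) auto
      also have "\<dots> \<le> card {l. w j \<in> J l} + card {l. w (Suc j) \<in> J l}" by (rule card_Un_le)
      also have "\<dots> \<le> 2" using at_most_one[of "w j"] at_most_one[of "w (Suc j)"] by linarith
      \<comment> \<open>The count gives 2; it is relaxed to the 4 of the claimed bound.\<close>
      finally have V: "card V \<le> 4" by simp
      have "(\<Sum>l\<in>Bd. q l j) = (\<Sum>l\<in>V. q l j)"
        by (rule sum.mono_neutral_right) (use finG in \<open>auto simp: V_def q_def\<close>)
      also have "\<dots> = real (card V) * (\<zeta>\<^sup>2 * n j / real L)"
        by (simp add: V_def q_def)
      also have "\<dots> \<le> 4 * (\<zeta>\<^sup>2 * n j / real L)"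
        using V nn[of j] by (intro mult_right_mono) auto
      finally show "(\<Sum>l\<in>Bd. q l j) \<le> 4 * \<zeta>\<^sup>2 / real L * n j" by simp
    qed
    also have "\<dots> \<le> 4 * \<zeta>\<^sup>2 / real L * (L2_norm U t)\<^sup>2"
      using mult_left_mono[OF sum_n, of "4 * \<zeta>\<^sup>2 / real L"] by (simp add: sum_distrib_left)
    finally show ?thesis .
  qed
  have bad0: "(\<Sum>l\<in>Bd. \<integral>x. (cmod (t x))\<^sup>2 \<partial>lebesgue_on (J l))
     \<le> (if k = 0 then 0 else 4 * \<zeta>\<^sup>2 / real L) * (L2_norm U t)\<^sup>2"
  proof (cases "k = 0")
    case True
    then have "Bd = {}" by (auto simp: Bd_def G_def)
    then show ?thesis using True by simp
  qed (use bad in simp)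
  have "(L2_norm U (\<lambda>x. t x - s x))\<^sup>2
    \<le> (\<gamma>\<^sup>2 / (pi * real L)\<^sup>2 + (if k = 0 then 0 else 4 * \<zeta>\<^sup>2 / real L)) * (L2_norm U t)\<^sup>2"
    unfolding distrib_right using split good bad0 by linarith
  then show ?thesis using sS unfolding U_def by blast
qed

theorem lemma2:
  fixes k L :: nat
    and w :: "nat \<Rightarrow> real"
    and T :: "(real \<Rightarrow> complex) set"
  assumes "w 0 = 0" and "w (Suc k) = 1" and "\<And>j. j \<le> k \<Longrightarrow> w j < w (Suc j)"
    and "L \<ge> 1"
    and "L2_subspace {0<..<1} T" and "L2_finite_dim {0<..<1} T"
    and "T \<subseteq> H1_pw k w"
    and "1 / real L \<le> (MIN j\<in>{..k}. w (Suc j) - w j)"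
  defines "\<gamma> \<equiv> enn2real (gamma_const k w T)"
    and "\<zeta> \<equiv> enn2real (zeta_const k w T)"
  shows "gap (step_space L) T \<le> sqrt (\<gamma>\<^sup>2 / (pi * real L)\<^sup>2 + 4 * \<zeta>\<^sup>2 / real L) \<and>
         (k = 0 \<longrightarrow> gap (step_space L) T \<le> \<gamma> / (pi * real L))"
proof -
  define z where "z = (if k = 0 then 0 else 4 * \<zeta>\<^sup>2 / real L)"
  have z: "0 \<le> z" "z \<le> 4 * \<zeta>\<^sup>2 / real L" by (simp_all add: z_def)
  have gap: "gap (step_space L) T \<le> sqrt (\<gamma>\<^sup>2 / (pi * real L)\<^sup>2 + z)"
  proof (rule gap_le[OF step_space_subspace step_space_finite_dim[OF assms(4)] assms(5,6)])
    show "0 \<le> \<gamma>\<^sup>2 / (pi * real L)\<^sup>2 + z" using z by simp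
    show "\<exists>s\<in>step_space L. (L2_norm {0<..<1} (\<lambda>x. t x - s x))\<^sup>2
        \<le> (\<gamma>\<^sup>2 / (pi * real L)\<^sup>2 + z) * (L2_norm {0<..<1} t)\<^sup>2" if "t \<in> T" for t
      unfolding z_def \<gamma>_def \<zeta>_def by (rule step_approximation[OF assms(1-7) that])
  qed
  also have "\<dots> \<le> sqrt (\<gamma>\<^sup>2 / (pi * real L)\<^sup>2 + 4 * \<zeta>\<^sup>2 / real L)" using z by simp
  finally have 1: "gap (step_space L) T \<le> sqrt (\<gamma>\<^sup>2 / (pi * real L)\<^sup>2 + 4 * \<zeta>\<^sup>2 / real L)" .
  have "gap (step_space L) T \<le> \<gamma> / (pi * real L)" if "k = 0"
  proof -
    \<comment> \<open>For k = 0 the term z is 0, so the radicand is a perfect square of a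
      nonnegative number.\<close>
    have "gap (step_space L) T \<le> sqrt ((\<gamma> / (pi * real L))\<^sup>2)"
      using gap that by (simp add: z_def power_divide)
    then show ?thesis by (simp add: \<gamma>_def)
  qed
  with 1 show ?thesis by blast
qed

end
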